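(* Suppose for every $i\in\mathbb{N}$ that the group $G_i$ is a copy of $\mathbb{T}^2=\mathbb{R}^2/\mathbb{Z}^2$ and that the homomorphism $\phi_i$ is a fixed ergodic toral automorphism given by a matrix $S$. Suppose that for every $k$ the noise distribution $\mu_k$ is a fixed Borel probability measure $\mu^*$ on $\mathbb{T}^2$ that satisfies $\mu^*(A)\ge\epsilon\,\lambda(A\cap B)$ for every Borel set $A\subseteq\mathbb{T}^2$, where $\epsilon>0$, $\lambda$ is normalized Haar measure on $\mathbb{T}^2$, and $B$ is a fixed Borel set with $\lambda(B)>0$. Then $\mathcal{P}_\mu^{\mathrm{strong}}=\emptyset$.
   Context: $\mathbb{N}=\{1,2,\dots\}$. A linear toral automorphism is a map $x\mapsto Sx$ (modulo $\mathbb{Z}^2$) of $\mathbb{T}^2$ to itself, where $S$ is a $2\times2$ integer matrix with determinant $1$. It is ergodic if $S$ has no eigenvalues on the unit circle. General setting: given compact Hausdorff groups $G_k$ with countable bases, continuous homomorphisms $\phi_k:G_{k+1}\to G_k$, and Borel probability measures $\mu_k$ on $G_k$ ($k\in\mathbb{N}$), let $\mu=(\mu_k)_{k\in\mathbb{N}}$ and $G:=\prod_{k\in\mathbb{N}}G_k$. Let $X_k:G\to G_k$ be the $k$-th coordinate map and $Z_k:=\phi_k(X_{k+1})^{-1}X_k$. The set $\mathcal{P}_\mu$ of solutions of the stochastic equation associated with $\mu$ is the set of Borel probability measures $\mathbb{P}$ on $G$ such that for every $k\in\mathbb{N}$ and every bounded Borel $f:G_k\to\mathbb{R}$, the conditional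 expectation of $f(X_k)$ given $(X_j)_{j>k}$ under $\mathbb{P}$ equals $\int_{G_k}f(\phi_k(X_{k+1})z)\,\mu_k(dz)$ $\mathbb{P}$-a.s.; equivalently, for every $k$, under $\mathbb{P}$ the variable $Z_k$ has distribution $\mu_k$ and is independent of $(X_j)_{j>k}$. A solution $\mathbb{P}\in\mathcal{P}_\mu$ is strong if for each $k\in\mathbb{N}$ the variable $X_k$ is measurable, up to $\mathbb{P}$-null sets, with respect to $\sigma((Z_j)_{j\ge k})$; $\mathcal{P}_\mu^{\mathrm{strong}}$ denotes the set of strong solutions. *)

theory Defs
  imports "HOL-Probability.Probability"
begin

section \<open>Compact groups and Haar measure\<close>

text \<open>Groups are written additively, but commutativity is not assumed.\<close>

class compact_group = topological_group_add + t2_space + second_countable_topology +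
  assumes compact_UNIV_group: "compact UNIV"

definition borel_prob :: "'a::topological_space measure \<Rightarrow> bool" where
  "borel_prob M \<longleftrightarrow> prob_space M \<and> sets M = sets borel"

text \<open>Regularity is automatic, as the groups considered are compact with a countable base.\<close>

definition normalized_haar :: "'a::compact_group measure \<Rightarrow> bool" where
  "normalized_haar M \<longleftrightarrow> borel_prob M \<and> (\<forall>a. distr M borel (\<lambda>x. a + x) = M)"


section \<open>Stochastic equations\<close>

text \<open>All groups \<open>G\<^sub>k\<close> are copies of one group, given by the type \<open>'a\<close>; the index set is
  \<open>{0, 1, 2, \<dots>}\<close>. A point of the product \<open>G\<close> is a sequence \<open>x :: nat \<Rightarrow> 'a\<close>, whose \<open>k\<close>-th
  coordinate \<open>X\<^sub>k\<close> is \<open>x k\<close>, and the topology of the function type is the product topology.\<close>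

definition sigma_family :: "'i set \<Rightarrow> ('i \<Rightarrow> 'b \<Rightarrow> 'a::topological_space) \<Rightarrow> 'b measure" where
  "sigma_family J Y = sigma UNIV (\<Union>j\<in>J. {Y j -` A | A. A \<in> sets borel})"

definition noise :: "(nat \<Rightarrow> 'a::group_add \<Rightarrow> 'a) \<Rightarrow> nat \<Rightarrow> (nat \<Rightarrow> 'a) \<Rightarrow> 'a" where
  "noise \<phi> k x = - \<phi> k (x (Suc k)) + x k"

definition solutions ::
    "(nat \<Rightarrow> 'a::compact_group \<Rightarrow> 'a) \<Rightarrow> (nat \<Rightarrow> 'a measure) \<Rightarrow> (nat \<Rightarrow> 'a) measure set" where
  "solutions \<phi> \<mu> = {P. borel_prob P \<and>
     (\<forall>k. \<forall>f :: 'a \<Rightarrow> real. f \<in> borel_measurable borel \<and> bounded (range f) \<longrightarrow>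
       (AE x in P. real_cond_exp P (sigma_family {k<..} (\<lambda>j x. x j)) (\<lambda>x. f (x k)) x
          = (\<integral>z. f (\<phi> k (x (Suc k)) + z) \<partial>\<mu> k)))}"

text \<open>Measurability of \<open>X\<^sub>k\<close> up to \<open>P\<close>-null sets is expressed by a measurable \<open>Y\<close> that agrees
  with \<open>X\<^sub>k\<close> almost surely.\<close>

definition strong_solutions ::
    "(nat \<Rightarrow> 'a::compact_group \<Rightarrow> 'a) \<Rightarrow> (nat \<Rightarrow> 'a measure) \<Rightarrow> (nat \<Rightarrow> 'a) measure set" where
  "strong_solutions \<phi> \<mu> = {P \<in> solutions \<phi> \<mu>.
     \<forall>k. \<exists>Y \<in> borel_measurable (sigma_family {k..} (noise \<phi>)). AE x in P. x k = Y x}"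


section \<open>The torus\<close>

definition int_lattice_rel :: "real ^ 2 \<Rightarrow> real ^ 2 \<Rightarrow> bool" where
  "int_lattice_rel x y \<longleftrightarrow> (\<forall>i. x $ i - y $ i \<in> \<int>)"

quotient_type torus = "real ^ 2" / int_lattice_rel
proof (rule equivpI)
  show "reflp int_lattice_rel"
    by (auto simp: reflp_def int_lattice_rel_def)
  show "symp int_lattice_rel"
    by (auto simp: symp_def int_lattice_rel_def Ints_minus minus_in_Ints_iff intro: iffD1[OF minus_in_Ints_iff])
  show "transp int_lattice_rel"
    unfolding transp_def int_lattice_rel_def by (metis Ints_add diff_add_cancel add_diff_eq)
qed

instantiation torus :: ab_group_add
begin

lift_definition zero_torus :: torus is 0 .

lift_definition plus_torus :: "torus \<Rightarrow> torus \<Rightarrow> torus" is "(+)"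
proof -
  fix x x' y y' :: "real ^ 2"
  assume "int_lattice_rel x x'" "int_lattice_rel y y'"
  then have "(x $ i - x' $ i) + (y $ i - y' $ i) \<in> \<int>" for i
    unfolding int_lattice_rel_def by (intro Ints_add) blast+
  then show "int_lattice_rel (x + y) (x' + y')"
    by (simp add: int_lattice_rel_def algebra_simps)
qed

lift_definition uminus_torus :: "torus \<Rightarrow> torus" is uminus
proof -
  fix x x' :: "real ^ 2"
  assume "int_lattice_rel x x'"
  then have "- (x $ i - x' $ i) \<in> \<int>" for i
    unfolding int_lattice_rel_def by (intro Ints_minus) blast
  then show "int_lattice_rel (- x) (- x')"
    by (simp add: int_lattice_rel_def)
qed

lift_definition minus_torus :: "torus \<Rightarrow> torus \<Rightarrow> torus" is "(-)"
proof -
  fix x x' y y' :: "real ^ 2"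
  assume "int_lattice_rel x x'" "int_lattice_rel y y'"
  then have "(x $ i - x' $ i) - (y $ i - y' $ i) \<in> \<int>" for i
    unfolding int_lattice_rel_def by (metis Ints_diff)
  then show "int_lattice_rel (x - y) (x' - y')"
    by (simp add: int_lattice_rel_def algebra_simps)
qed

instance
  by standard (transfer; simp add: int_lattice_rel_def algebra_simps)+

end

instantiation torus :: topological_space
begin

definition open_torus :: "torus set \<Rightarrow> bool" where
  "open_torus U \<longleftrightarrow> open (abs_torus -` U)"

instance
  by standard (auto simp: open_torus_def vimage_Union)

end

lemma abs_torus_eq_iff: "abs_torus x = abs_torus y \<longleftrightarrow> int_lattice_rel x y"
  using Quotient_rel_abs[OF Quotient_torus] torus.abs_eq_iff by blast

lemma abs_torus_surj: "\<exists>x. abs_torus x = t"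
  by (meson Quotient_abs_rep[OF Quotient_torus])

lemma continuous_abs_torus: "continuous_on UNIV abs_torus"
  by (simp add: continuous_on_open_vimage open_torus_def)

lemma open_abs_torus_image:
  assumes "open U" shows "open (abs_torus ` U)"
proof -
  let ?L = "{v :: real ^ 2. \<forall>i. v $ i \<in> \<int>}"
  have "abs_torus -` (abs_torus ` U) = (\<Union>v\<in>?L. (\<lambda>x. v + x) ` U)"
  proof (rule set_eqI)
    fix y
    have "y \<in> abs_torus -` (abs_torus ` U) \<longleftrightarrow> (\<exists>x\<in>U. int_lattice_rel y x)"
      by (auto simp: abs_torus_eq_iff image_iff)
    also have "\<dots> \<longleftrightarrow> (\<exists>x\<in>U. y - x \<in> ?L)"
      by (simp add: int_lattice_rel_def)
    also have "\<dots> \<longleftrightarrow> y \<in> (\<Union>v\<in>?L. (\<lambda>x. v + x) ` U)"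
    proof
      assume "\<exists>x\<in>U. y - x \<in> ?L"
      then obtain x where "x \<in> U" "y - x \<in> ?L" by blast
      then show "y \<in> (\<Union>v\<in>?L. (\<lambda>x. v + x) ` U)"
        by (intro UN_I[of "y - x"] image_eqI[of _ _ x]) auto
    next
      assume "y \<in> (\<Union>v\<in>?L. (\<lambda>x. v + x) ` U)"
      then obtain v x where "v \<in> ?L" "x \<in> U" "y = v + x" by blast
      then have "y - x \<in> ?L" by simp
      then show "\<exists>x\<in>U. y - x \<in> ?L" using \<open>x \<in> U\<close> by blast
    qed
    finally show "y \<in> abs_torus -` (abs_torus ` U) \<longleftrightarrow> y \<in> (\<Union>v\<in>?L. (\<lambda>x. v + x) ` U)" .
  qed
  then show ?thesis
    using assms by (auto simp: open_torus_def intro!: open_UN open_translation)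
qed

lemma continuous_on_torus_lift:
  fixes f :: "torus \<Rightarrow> 'b::topological_space"
  assumes "continuous_on UNIV (\<lambda>x. f (abs_torus x))"
  shows "continuous_on UNIV f"
  using assms by (simp add: continuous_on_open_vimage open_torus_def vimage_def)

text \<open>The Hausdorff property comes from an injective continuous map into the plane.\<close>

lift_definition torus_embed :: "torus \<Rightarrow> complex ^ 2" is "\<lambda>x. \<chi> i. cis (2 * pi * x $ i)"
proof -
  fix x y :: "real ^ 2" assume "int_lattice_rel x y"
  then have "cis (2 * pi * (x $ i - y $ i)) = 1" for i
    by (metis cis_multiple_2pi int_lattice_rel_def)
  then have "cis (2 * pi * x $ i) / cis (2 * pi * y $ i) = 1" for i
    by (simp add: cis_divide right_diff_distrib)
  then show "(\<chi> i. cis (2 * pi * x $ i)) = (\<chi> i. cis (2 * pi * y $ i))"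
    by (simp add: vec_eq_iff)
qed

lemma continuous_torus_embed: "continuous_on UNIV torus_embed"
  by (rule continuous_on_torus_lift)
    (auto simp: torus_embed.abs_eq intro!: continuous_intros)

lemma inj_torus_embed: "inj torus_embed"
proof (rule injI, transfer)
  fix x y :: "real ^ 2"
  assume "(\<chi> i. cis (2 * pi * x $ i)) = (\<chi> i. cis (2 * pi * y $ i))"
  then have eq: "cis (2 * pi * x $ i) = cis (2 * pi * y $ i)" for i
    by (simp add: vec_eq_iff)
  have "x $ i - y $ i \<in> \<int>" for i
  proof -
    have "cis (2 * pi * (x $ i - y $ i)) = 1"
      using eq[of i] by (simp add: right_diff_distrib flip: cis_divide)
    then have "cos (2 * pi * (x $ i - y $ i)) = 1"
      by (metis Re_complex_of_real cis.simps(1) of_real_1)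
    then obtain n :: int where "2 * pi * (x $ i - y $ i) = of_int n * 2 * pi"
      using cos_one_2pi_int by blast
    then have "x $ i - y $ i = of_int n"
      by simp
    then show ?thesis by simp
  qed
  then show "int_lattice_rel x y"
    by (simp add: int_lattice_rel_def)
qed

instance torus :: compact_group
proof
  fix a b :: torus
  obtain x y where xy: "a = abs_torus x" "b = abs_torus y"
    by (metis abs_torus_surj)
  show "LIM p (nhds a \<times>\<^sub>F nhds b). fst p + snd p :> nhds (a + b)"
    unfolding filterlim_iff
  proof (intro allI impI)
    fix Q assume "\<forall>\<^sub>F t in nhds (a + b). Q t"
    then obtain W where W: "open W" "a + b \<in> W" "\<And>t. t \<in> W \<Longrightarrow> Q t"
      by (auto simp: eventually_nhds)
    have 1: "open ((\<lambda>p. fst p + snd p) -` (abs_torus -` W) :: ((real^2) \<times> (real^2)) set)"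
      using W(1) unfolding open_torus_def[of W]
      by (rule open_vimage) (intro continuous_intros)
    have 2: "(x, y) \<in> (\<lambda>p. fst p + snd p) -` (abs_torus -` W)"
      using W(2) xy by (simp add: plus_torus.abs_eq)
    obtain U V where UV: "open U" "open V" "x \<in> U" "y \<in> V"
      "U \<times> V \<subseteq> (\<lambda>p. fst p + snd p) -` (abs_torus -` W)"
      by (rule open_prod_elim[OF 1 2]) auto
    have "Q (s + t)" if "s \<in> abs_torus ` U" "t \<in> abs_torus ` V" for s t
      using that UV(5) W(3) by (auto simp: plus_torus.abs_eq)
    then show "\<forall>\<^sub>F p in nhds a \<times>\<^sub>F nhds b. Q (fst p + snd p)"
      unfolding eventually_prod_filter
      using UV xy open_abs_torus_image[OF UV(1)] open_abs_torus_image[OF UV(2)]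
      by (intro exI[of _ "\<lambda>s. s \<in> abs_torus ` U"] exI[of _ "\<lambda>t. t \<in> abs_torus ` V"])
        (auto intro!: eventually_nhds_in_open)
  qed
  have "continuous_on UNIV (uminus :: torus \<Rightarrow> torus)"
  proof (rule continuous_on_torus_lift)
    have "continuous_on UNIV (abs_torus \<circ> uminus)"
      by (intro continuous_on_compose continuous_intros)
        (rule continuous_on_subset[OF continuous_abs_torus], simp)
    then show "continuous_on UNIV (\<lambda>x. - abs_torus x)"
      by (simp add: uminus_torus.abs_eq o_def)
  qed
  then show "(uminus \<longlongrightarrow> - a) (nhds a)"
    unfolding continuous_on_def tendsto_at_iff_tendsto_nhds by blast
next
  fix a b :: torus assume "a \<noteq> b"
  then have "torus_embed a \<noteq> torus_embed b"
    by (metis inj_torus_embed injD)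
  then obtain U V where UV: "open U" "open V" "torus_embed a \<in> U" "torus_embed b \<in> V" "U \<inter> V = {}"
    by (metis hausdorff)
  have "open (torus_embed -` U)" "open (torus_embed -` V)"
    using UV continuous_torus_embed by (auto simp: continuous_on_open_vimage)
  then show "\<exists>U V. open U \<and> open V \<and> a \<in> U \<and> b \<in> V \<and> U \<inter> V = {}"
    using UV by (intro exI[of _ "torus_embed -` U"] exI[of _ "torus_embed -` V"]) auto
next
  obtain B :: "(real ^ 2) set set" where B: "countable B" "topological_basis B"
    using ex_countable_basis by blast
  have "topological_basis ((`) abs_torus ` B)"
  proof (rule topological_basisI)
    fix W assume "W \<in> (`) abs_torus ` B"
    then show "open W"
      using B(2) open_abs_torus_image topological_basis_open by blast
  next
    fix W and t :: torus assume W: "open W" "t \<in> W"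
    obtain x where x: "t = abs_torus x" by (metis abs_torus_surj)
    have "open (abs_torus -` W)" "x \<in> abs_torus -` W"
      using W x by (auto simp: open_torus_def)
    then obtain U where "U \<in> B" "x \<in> U" "U \<subseteq> abs_torus -` W"
      using topological_basisE[OF B(2)] by blast
    then show "\<exists>B'\<in>(`) abs_torus ` B. t \<in> B' \<and> B' \<subseteq> W"
      using x by (intro bexI[of _ "abs_torus ` U"]) auto
  qed
  then show "\<exists>B :: torus set set. countable B \<and> open = generate_topology B"
    using B(1) topological_basis_imp_subbasis countable_image by metis
next
  have "t \<in> abs_torus ` cbox 0 1" for t
  proof -
    obtain x where x: "t = abs_torus x" by (metis abs_torus_surj)
    have "int_lattice_rel x (\<chi> i. frac (x $ i))"
      by (simp add: int_lattice_rel_def frac_def)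
    then have "t = abs_torus (\<chi> i. frac (x $ i))"
      using x by (simp add: abs_torus_eq_iff)
    moreover have "(\<chi> i. frac (x $ i)) \<in> cbox 0 1"
      by (simp add: mem_box_cart less_imp_le[OF frac_lt_1])
    ultimately show ?thesis by blast
  qed
  then have "abs_torus ` cbox 0 1 = UNIV" by blast
  then show "compact (UNIV :: torus set)"
    using compact_continuous_image[OF continuous_on_subset[OF continuous_abs_torus] compact_cbox]
    by (metis top_greatest)
qed


section \<open>Toral automorphisms\<close>

lift_definition toral_map :: "int ^ 2 ^ 2 \<Rightarrow> torus \<Rightarrow> torus"
  is "\<lambda>S x. map_matrix real_of_int S *v x"
proof -
  fix S :: "int ^ 2 ^ 2" and x y :: "real ^ 2" assume "int_lattice_rel x y"
  then have "(\<Sum>j\<in>UNIV. of_int (S $ i $ j) * (x $ j - y $ j)) \<in> \<int>" for i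
    by (intro Ints_sum Ints_mult) (auto simp: int_lattice_rel_def)
  then show "int_lattice_rel (map_matrix real_of_int S *v x) (map_matrix real_of_int S *v y)"
    by (simp add: int_lattice_rel_def matrix_vector_mult_def right_diff_distrib sum_subtractf)
qed

lemma toral_map_add: "toral_map S (s + t) = toral_map S s + toral_map S t"
  by transfer (simp add: int_lattice_rel_def matrix_vector_right_distrib)

lemma continuous_toral_map: "continuous_on UNIV (toral_map S)"
proof (rule continuous_on_torus_lift)
  have "continuous_on UNIV (abs_torus \<circ> (*v) (map_matrix real_of_int S))"
    by (intro continuous_on_compose matrix_vector_mult_linear_continuous_on)
      (rule continuous_on_subset[OF continuous_abs_torus], simp)
  then show "continuous_on UNIV (\<lambda>x. toral_map S (abs_torus x))"
    by (simp add: toral_map.abs_eq o_def)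
qed

definition complex_eigenvalue :: "int ^ 'n ^ 'n \<Rightarrow> complex \<Rightarrow> bool" where
  "complex_eigenvalue S c \<longleftrightarrow>
     (\<exists>v :: complex ^ 'n. v \<noteq> 0 \<and> map_matrix of_int S *v v = c *s v)"

definition ergodic_toral_matrix :: "int ^ 2 ^ 2 \<Rightarrow> bool" where
  "ergodic_toral_matrix S \<longleftrightarrow>
     det S = 1 \<and> (\<forall>c. complex_eigenvalue S c \<longrightarrow> cmod c \<noteq> 1)"

end

theory Submission
  imports Defs
begin

text \<open>Let \<open>\<chi>\<close> be the character \<open>t \<mapsto> exp (2 \<pi> i t\<^sub>1)\<close> of the torus and \<open>\<chi>\<^sub>n = \<chi> \<circ> S\<^sup>n\<close>, again a
  character. Iterating the equation \<open>X\<^sub>k = S X\<^sub>k\<^sub>+\<^sub>1 + Z\<^sub>k\<close> gives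
  \<open>\<chi>(X\<^sub>0) = \<chi>\<^sub>0(Z\<^sub>0) \<cdots> \<chi>\<^sub>n\<^sub>-\<^sub>1(Z\<^sub>n\<^sub>-\<^sub>1) \<cdot> \<chi>\<^sub>n(X\<^sub>n)\<close>. For a solution, \<open>X\<^sub>n\<close> is independent of
  \<open>Z\<^sub>0, \<dots>, Z\<^sub>n\<^sub>-\<^sub>1\<close> (\<open>indep_noise_before_past\<close>), so for every event \<open>A\<close> that these variables
  determine, \<open>\<bar>E (1\<^sub>A \<chi>(X\<^sub>0))\<bar> \<le> \<bar>E \<chi>\<^sub>n(X\<^sub>n)\<bar> P(A)\<close>. As \<open>Z\<^sub>n\<close> is an independent summand of \<open>X\<^sub>n\<close>,
  the factor \<open>\<bar>E \<chi>\<^sub>n(X\<^sub>n)\<bar>\<close> is at most \<open>\<bar>\<integral> \<chi>\<^sub>n d\<mu>\<^sup>*\<bar>\<close>.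

  The noise is not concentrated enough for the latter to approach 1: the part
  \<open>\<epsilon> 1\<^sub>B \<lambda>\<close> of \<open>\<mu>\<^sup>*\<close> has mass \<open>\<epsilon> \<lambda>(B)\<close>, and its Fourier coefficients along the sequence
  \<open>\<chi>\<^sub>n\<close> vanish in the limit by the Riemann--Lebesgue lemma, because ergodicity of \<open>S\<close>
  makes the characters \<open>\<chi>\<^sub>n\<close> pairwise different (\<open>inj_toral_frequencies\<close>). Hence
  \<open>\<bar>\<integral> \<chi>\<^sub>n d\<mu>\<^sup>*\<bar> \<le> c\<close> for all large \<open>n\<close>, with \<open>c = 1 - \<epsilon> \<lambda>(B) / 2 < 1\<close>
  (\<open>norm_integral_le_of_minorization\<close>).

  Thus \<open>\<bar>E (1\<^sub>A \<chi>(X\<^sub>0))\<bar> \<le> c P(A)\<close> for all \<open>A\<close> in the algebra of events that depend on finitely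
  many noise variables, and by approximation (\<open>measure_sym_diff_approx\<close>) for all \<open>A\<close> in the
  \<open>\<sigma>\<close>-algebra generated by the whole noise. A function of modulus 1 that is measurable for this
  \<open>\<sigma>\<close>-algebra is nearly constant on some event of positive probability and so violates the bound
  (\<open>unimodular_set_integral_bound\<close>). Therefore \<open>\<chi>(X\<^sub>0)\<close>, and with it \<open>X\<^sub>0\<close>, is not a function of
  the noise.\<close>

section \<open>Approximation and bounds for integrals of bounded complex functions\<close>

text \<open>The sets with approximants in \<open>\<A>\<close> form a \<open>\<sigma>\<close>-algebra: a countable union is approximated by
  a finite subunion, whose members are then approximated one by one.\<close>

lemma (in finite_measure) measure_sym_diff_approx:
  assumes "algebra (space M) \<A>" "\<A> \<subseteq> sets M" "A \<in> sigma_sets (space M) \<A>" "0 < \<delta>"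
  shows "\<exists>A'\<in>\<A>. measure M (sym_diff A A') < \<delta>"
  using assms(3,4)
proof (induction arbitrary: \<delta> rule: sigma_sets.induct)
  case (Basic A)
  then show ?case by (intro bexI[of _ A]) auto
next
  case Empty
  interpret algebra "space M" \<A> by fact
  show ?case using Empty by (intro bexI[of _ "{}"]) auto
next
  case (Compl A)
  interpret algebra "space M" \<A> by fact
  obtain A' where A': "A' \<in> \<A>" "measure M (sym_diff A A') < \<delta>"
    using Compl by blast
  have "A \<subseteq> space M"
    using Compl(1) space_closed sigma_sets_into_sp by blast
  moreover have "A' \<subseteq> space M"
    using A'(1) space_closed by blast
  ultimately have "sym_diff (space M - A) (space M - A') = sym_diff A A'"
    by blast
  then show ?case
    using A' by (intro bexI[of _ "space M - A'"]) auto
next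
  case (Union A)
  interpret algebra "space M" \<A> by fact
  have A_sets: "A i \<in> sets M" for i
    using Union(1) assms(2) sets.sigma_sets_subset by blast
  have "(\<lambda>n. measure M (\<Union>i\<le>n. A i)) \<longlonglongrightarrow> measure M (\<Union>n. \<Union>i\<le>n. A i)"
    using A_sets by (intro finite_Lim_measure_incseq) (auto simp: incseq_def, force)
  moreover have "(\<Union>n. \<Union>i\<le>n. A i) = (\<Union>i. A i)"
    by auto
  ultimately have "(\<lambda>n. measure M (\<Union>i\<le>n. A i)) \<longlonglongrightarrow> measure M (\<Union>i. A i)"
    by simp
  then have "\<forall>\<^sub>F n in sequentially. measure M (\<Union>i. A i) - \<delta> / 2 < measure M (\<Union>i\<le>n. A i)"
    using \<open>0 < \<delta>\<close> by (intro order_tendstoD) auto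
  then obtain n where n: "measure M (\<Union>i. A i) - \<delta> / 2 < measure M (\<Union>i\<le>n. A i)"
    by (auto simp: eventually_sequentially)
  have "\<exists>B. B \<in> \<A> \<and> measure M (sym_diff (A i) B) < \<delta> / (2 * (real n + 1))" for i
    using Union(2)[of "\<delta> / (2 * (real n + 1))" i] \<open>0 < \<delta>\<close> by auto
  then obtain B where B: "\<And>i. B i \<in> \<A>"
      "\<And>i. measure M (sym_diff (A i) (B i)) < \<delta> / (2 * (real n + 1))"
    by metis
  have B_sets: "B i \<in> sets M" for i
    using B(1) assms(2) by blast
  have "measure M (sym_diff (\<Union>i. A i) (\<Union>i\<le>n. B i))
      \<le> measure M (((\<Union>i. A i) - (\<Union>i\<le>n. A i)) \<union> (\<Union>i\<le>n. sym_diff (A i) (B i)))"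
    using A_sets B_sets by (intro finite_measure_mono sets.Un sets.Diff sets.countable_UN'' sets.finite_UN) auto
  also have "\<dots> \<le> measure M ((\<Union>i. A i) - (\<Union>i\<le>n. A i)) + measure M (\<Union>i\<le>n. sym_diff (A i) (B i))"
    using A_sets B_sets by (intro measure_Un_le sets.Un sets.Diff sets.finite_UN sets.countable_UN'') auto
  also have "measure M ((\<Union>i. A i) - (\<Union>i\<le>n. A i)) = measure M (\<Union>i. A i) - measure M (\<Union>i\<le>n. A i)"
    using A_sets by (intro finite_measure_Diff sets.finite_UN sets.countable_UN'') auto
  also have "measure M (\<Union>i\<le>n. sym_diff (A i) (B i)) \<le> (\<Sum>i\<le>n. measure M (sym_diff (A i) (B i)))"
    using A_sets B_sets by (intro finite_measure_subadditive_finite) auto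
  also have "\<dots> \<le> (\<Sum>i\<le>n. \<delta> / (2 * (real n + 1)))"
    using B(2) less_imp_le by (intro sum_mono) blast
  also have "\<dots> = \<delta> / 2"
    by (simp add: field_simps)
  finally have "measure M (sym_diff (\<Union>i. A i) (\<Union>i\<le>n. B i)) < \<delta>"
    using n by linarith
  moreover have "(\<Union>i\<le>n. B i) \<in> \<A>"
    using B(1) by auto
  ultimately show ?case by blast
qed

text \<open>If \<open>c < 1\<close>, take a small disc with centre \<open>w\<close> that \<open>g\<close> hits with positive probability;
  countably many discs cover the plane, so there is one. On the event \<open>A\<close> that \<open>g\<close> lies in the disc,
  \<open>g\<close> is almost the constant \<open>w\<close>, so its integral over \<open>A\<close> has modulus close to the measure
  of \<open>A\<close>.\<close>

lemma (in prob_space) unimodular_set_integral_bound: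
  fixes g :: "'a \<Rightarrow> complex"
  assumes "subalgebra M G" and g: "g \<in> borel_measurable G" and "\<And>x. norm (g x) = 1"
    and bound: "\<And>A. A \<in> sets G \<Longrightarrow> norm (\<integral>x. indicator A x *\<^sub>R g x \<partial>M) \<le> c * measure M A"
  shows "1 \<le> c"
proof (rule ccontr)
  assume "\<not> 1 \<le> c"
  \<comment> \<open>Below, \<open>\<bar>w\<bar> \<ge> 1 - \<delta>\<close> meets \<open>\<bar>w\<bar> \<le> c + \<delta>\<close>, which is contradictory once \<open>2 \<delta> < 1 - c\<close>.\<close>
  define \<delta> where "\<delta> = (1 - c) / 3"
  have "\<delta> > 0" using \<open>\<not> 1 \<le> c\<close> by (simp add: \<delta>_def)
  have sp: "space G = space M" and GM: "sets G \<subseteq> sets M"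
    using assms(1) by (auto simp: subalgebra_def)
  obtain D :: "complex set" where D: "countable D" "\<And>X. open X \<Longrightarrow> X \<noteq> {} \<Longrightarrow> \<exists>d\<in>D. d \<in> X"
    using countable_dense_exists by metis
  define A where "A w = {x \<in> space M. g x \<in> ball w \<delta>}" for w
  have AG: "A w \<in> sets G" for w
    using measurable_sets[OF g, of "ball w \<delta>"] by (simp add: A_def sp vimage_def Int_def conj_commute)
  have "A w \<in> null_sets M" for w
  proof (rule ccontr)
    assume "A w \<notin> null_sets M"
    then have pos: "measure M (A w) > 0"
      using AG GM by (auto simp: null_sets_def emeasure_eq_measure zero_less_measure_iff)
    then have "A w \<noteq> {}" by auto
    then obtain x where x: "x \<in> A w" by blast
    have "norm (g x) \<le> norm w + norm (g x - w)"
      by (metis add.commute diff_add_cancel norm_triangle_ineq)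
    then have w: "norm w \<ge> 1 - \<delta>"
      using x assms(3)[of x] by (auto simp: A_def dist_norm norm_minus_commute)
    have [measurable]: "A w \<in> sets M" using AG GM by blast
    have [measurable]: "g \<in> borel_measurable M"
      using measurable_from_subalg[OF assms(1) g] .
    have int1: "integrable M (\<lambda>x. indicator (A w) x *\<^sub>R g x)"
      by (rule integrable_const_bound[of _ 1]) (auto simp: indicator_def assms(3))
    have int2: "integrable M (\<lambda>x. indicator (A w) x *\<^sub>R w)"
      by (rule integrable_const_bound[of _ "norm w"]) (auto simp: indicator_def)
    have int3: "integrable M (\<lambda>x. indicator (A w) x * \<delta>)"
      by (rule integrable_const_bound[of _ \<delta>]) (use \<open>\<delta> > 0\<close> in \<open>auto simp: indicator_def\<close>)
    have "norm w * measure M (A w) = norm (\<integral>x. indicator (A w) x *\<^sub>R w \<partial>M)"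
      by (subst integral_scaleR_left) (auto simp: less_top[symmetric])
    also have "\<dots> = norm ((\<integral>x. indicator (A w) x *\<^sub>R g x \<partial>M)
        - (\<integral>x. indicator (A w) x *\<^sub>R g x - indicator (A w) x *\<^sub>R w \<partial>M))"
      using int1 int2 by (simp del: integral_scaleR_left)
    also have "\<dots> \<le> norm (\<integral>x. indicator (A w) x *\<^sub>R g x \<partial>M)
        + norm (\<integral>x. indicator (A w) x *\<^sub>R g x - indicator (A w) x *\<^sub>R w \<partial>M)"
      by (rule norm_triangle_ineq4)
    also have "norm (\<integral>x. indicator (A w) x *\<^sub>R g x - indicator (A w) x *\<^sub>R w \<partial>M)
        \<le> (\<integral>x. indicator (A w) x * \<delta> \<partial>M)"
      by (intro order_trans[OF integral_norm_bound integral_mono] integrable_norm Bochner_Integration.integrable_diff int1 int2 int3)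
        (auto simp: A_def indicator_def dist_norm norm_minus_commute)
    also have "(\<integral>x. indicator (A w) x * \<delta> \<partial>M) = \<delta> * measure M (A w)"
      by simp
    finally have "norm w * measure M (A w) \<le> (c + \<delta>) * measure M (A w)"
      using bound[OF AG[of w]] by (simp add: algebra_simps)
    then have "norm w \<le> c + \<delta>"
      using pos by simp
    with w \<open>\<delta> > 0\<close> show False by (simp add: \<delta>_def field_simps)
  qed
  then have "(\<Union>w\<in>D. A w) \<in> null_sets M"
    using D(1) by (intro null_sets_UN') auto
  moreover have "(\<Union>w\<in>D. A w) = space M"
  proof -
    have "\<exists>w\<in>D. x \<in> A w" if "x \<in> space M" for x
      using D(2)[of "ball (g x) \<delta>"] that \<open>\<delta> > 0\<close> by (auto simp: A_def dist_commute)
    then show ?thesis by (auto simp: A_def)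
  qed
  ultimately show False
    using emeasure_space_1 by (simp add: null_sets_def)
qed

text \<open>Rotate \<open>g\<close> by a unimodular \<open>w\<close> such that \<open>w \<integral> g dM\<close> is the modulus of the integral. The function
  \<open>1 - Re (w g)\<close> is nonnegative, so its integral against \<open>M\<close> dominates its integral against the
  minorizing measure \<open>\<epsilon> 1\<^sub>B N\<close>.\<close>

lemma (in prob_space) norm_integral_le_of_minorization:
  fixes g :: "'a \<Rightarrow> complex"
  assumes N: "prob_space N" "sets N = sets M" and B: "B \<in> sets M" and "0 < \<epsilon>"
    and minor: "\<And>A. A \<in> sets M \<Longrightarrow> \<epsilon> * measure N (A \<inter> B) \<le> measure M A"
    and g[measurable]: "g \<in> borel_measurable M" and g1: "\<And>x. norm (g x) \<le> 1"
  shows "norm (\<integral>x. g x \<partial>M) \<le> 1 - \<epsilon> * (measure N B - norm (\<integral>x. indicator B x *\<^sub>R g x \<partial>N))"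
proof -
  interpret N: prob_space N by fact
  have sp: "space N = space M" using N(2) by (rule sets_eq_imp_space_eq)
  have [measurable]: "B \<in> sets N" "g \<in> borel_measurable N" "B \<in> sets M"
    using B N(2) g by (auto cong: measurable_cong_sets)
  define I where "I = (\<integral>x. g x \<partial>M)"
  define w where "w = (if I = 0 then 1 else cnj (sgn I))"
  have w1: "norm w = 1" by (simp add: w_def norm_sgn)
  have wI: "w * I = of_real (norm I)"
    by (auto simp: w_def sgn_eq mult.commute[of "cnj _"] complex_norm_square[symmetric] power2_eq_square)
  define h where "h x = 1 - Re (w * g x)" for x
  have [measurable]: "h \<in> borel_measurable M" "h \<in> borel_measurable N"
    unfolding h_def by measurable
  have wg: "\<bar>Re (w * g x)\<bar> \<le> 1" for x
    using abs_Re_le_cmod[of "w * g x"] g1[of x] w1 by (simp add: norm_mult)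
  have h0: "0 \<le> h x" and h2: "h x \<le> 2" for x
    using wg[of x] by (auto simp: h_def abs_le_iff)
  have intg: "integrable M g"
    by (rule integrable_const_bound[of _ 1]) (auto simp: g1)
  have intgN: "integrable N (\<lambda>x. indicator B x *\<^sub>R g x)"
    by (rule N.integrable_const_bound[of _ 1]) (auto simp: g1 indicator_def)
  have "density N (\<lambda>x. ennreal \<epsilon> * indicator B x) \<le> M"
  proof -
    have "emeasure (density N (\<lambda>x. ennreal \<epsilon> * indicator B x)) A \<le> emeasure M A" for A
    proof (cases "A \<in> sets M")
      case True
      then have A[measurable]: "A \<in> sets N" using N(2) by simp
      have "emeasure (density N (\<lambda>x. ennreal \<epsilon> * indicator B x)) A
          = (\<integral>\<^sup>+x. ennreal \<epsilon> * indicator (A \<inter> B) x \<partial>N)"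
        by (subst emeasure_density) (auto simp: indicator_def intro!: nn_integral_cong)
      also have "\<dots> = ennreal (\<epsilon> * measure N (A \<inter> B))"
        using \<open>0 < \<epsilon>\<close> by (simp add: nn_integral_cmult N.emeasure_eq_measure ennreal_mult)
      also have "\<dots> \<le> emeasure M A"
        using minor[OF True] by (simp add: emeasure_eq_measure)
      finally show ?thesis .
    next
      case False
      then show ?thesis using N(2) by (simp add: emeasure_notin_sets)
    qed
    then show ?thesis
      using N(2) sp by (simp add: le_measure_iff le_fun_def)
  qed
  then have "(\<integral>\<^sup>+x. h x \<partial>density N (\<lambda>x. ennreal \<epsilon> * indicator B x)) \<le> (\<integral>\<^sup>+x. h x \<partial>M)"
    using N(2) by (intro nn_integral_mono_measure) auto
  moreover have "(\<integral>\<^sup>+x. h x \<partial>density N (\<lambda>x. ennreal \<epsilon> * indicator B x))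
      = ennreal (\<integral>x. \<epsilon> * (indicator B x * h x) \<partial>N)"
  proof -
    have "(\<integral>\<^sup>+x. h x \<partial>density N (\<lambda>x. ennreal \<epsilon> * indicator B x))
        = (\<integral>\<^sup>+x. ennreal (\<epsilon> * (indicator B x * h x)) \<partial>N)"
      using \<open>0 < \<epsilon>\<close> h0 by (subst nn_integral_density)
        (auto simp: indicator_def ennreal_mult intro!: nn_integral_cong)
    also have "\<dots> = ennreal (\<integral>x. \<epsilon> * (indicator B x * h x) \<partial>N)"
      using \<open>0 < \<epsilon>\<close> h0 h2 by (intro nn_integral_eq_integral N.integrable_const_bound[of _ "\<epsilon> * 2"])
        (auto simp: indicator_def abs_mult)
    finally show ?thesis .
  qed
  moreover have "(\<integral>\<^sup>+x. h x \<partial>M) = ennreal (\<integral>x. h x \<partial>M)"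
    using h0 h2 by (intro nn_integral_eq_integral integrable_const_bound[of _ 2]) auto
  ultimately have "(\<integral>x. \<epsilon> * (indicator B x * h x) \<partial>N) \<le> (\<integral>x. h x \<partial>M)"
    using h0 by (simp add: integral_nonneg)
  moreover have "(\<integral>x. h x \<partial>M) = 1 - norm I"
  proof -
    have "(\<integral>x. h x \<partial>M) = 1 - Re (w * I)"
      unfolding h_def I_def using intg by (simp add: prob_space)
    then show ?thesis by (simp add: wI)
  qed
  moreover have "(\<integral>x. \<epsilon> * (indicator B x * h x) \<partial>N)
      = \<epsilon> * (measure N B - Re (w * (\<integral>x. indicator B x *\<^sub>R g x \<partial>N)))"
  proof -
    have "(\<integral>x. indicator B x * h x \<partial>N)
        = (\<integral>x. indicator B x - Re (w * (indicator B x *\<^sub>R g x)) \<partial>N)"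
      by (intro Bochner_Integration.integral_cong) (auto simp: h_def indicator_def)
    also have "\<dots> = measure N B - Re (w * (\<integral>x. indicator B x *\<^sub>R g x \<partial>N))"
    proof -
      have "integrable N (\<lambda>x. w * (indicator B x *\<^sub>R g x))"
        using intgN by (rule integrable_mult_right)
      then have "integrable N (\<lambda>x. Re (w * (indicator B x *\<^sub>R g x)))"
          and "(\<integral>x. Re (w * (indicator B x *\<^sub>R g x)) \<partial>N) = Re (\<integral>x. w * (indicator B x *\<^sub>R g x) \<partial>N)"
        by (rule integrable_Re, rule integral_Re)
      moreover have "(\<integral>x. w * (indicator B x *\<^sub>R g x) \<partial>N) = w * (\<integral>x. indicator B x *\<^sub>R g x \<partial>N)"
        by (rule integral_mult_right_zero)
      moreover have "integrable N (indicator B :: 'a \<Rightarrow> real)"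
        by (auto simp: less_top[symmetric])
      ultimately show ?thesis
        by (subst Bochner_Integration.integral_diff) simp_all
    qed
    finally show ?thesis by simp
  qed
  moreover have "Re (w * (\<integral>x. indicator B x *\<^sub>R g x \<partial>N)) \<le> norm (\<integral>x. indicator B x *\<^sub>R g x \<partial>N)"
    using complex_Re_le_cmod[of "w * (\<integral>x. indicator B x *\<^sub>R g x \<partial>N)"] w1 by (simp add: norm_mult)
  then have "\<epsilon> * (measure N B - norm (\<integral>x. indicator B x *\<^sub>R g x \<partial>N))
      \<le> \<epsilon> * (measure N B - Re (w * (\<integral>x. indicator B x *\<^sub>R g x \<partial>N)))"
    using \<open>0 < \<epsilon>\<close> by simp
  ultimately show ?thesis unfolding I_def by linarith
qed

section \<open>The \<open>\<sigma>\<close>-algebra generated by a family\<close>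

lemma space_sigma_family [simp]: "space (sigma_family J Y) = UNIV"
  by (simp add: sigma_family_def space_measure_of_conv)

lemma sets_sigma_family:
  "sets (sigma_family J Y) = sigma_sets UNIV (\<Union>j\<in>J. {Y j -` A | A. A \<in> sets borel})"
  unfolding sigma_family_def by (intro sets_measure_of) auto

lemma measurable_sigma_family:
  assumes "j \<in> J" shows "Y j \<in> borel_measurable (sigma_family J Y)"
  using assms by (intro measurableI) (auto simp: sets_sigma_family)

lemma sets_sigma_family_subset:
  assumes "space N = UNIV" "\<And>j. j \<in> J \<Longrightarrow> Y j \<in> borel_measurable N"
  shows "sets (sigma_family J Y) \<subseteq> sets N"
proof -
  have "(\<Union>j\<in>J. {Y j -` A | A. A \<in> sets borel}) \<subseteq> sets N"
    using measurable_sets[OF assms(2)] assms(1) by fastforce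
  then show ?thesis
    using sets.sigma_sets_subset[of _ N] assms(1) by (simp add: sets_sigma_family)
qed

lemma subalgebra_sigma_family:
  assumes "space N = UNIV" "\<And>j. j \<in> J \<Longrightarrow> Y j \<in> borel_measurable N"
  shows "subalgebra N (sigma_family J Y)"
  using sets_sigma_family_subset[OF assms] assms(1) by (simp add: subalgebra_def)

lemma borel_prob_measurable_coordinate:
  fixes P :: "(nat \<Rightarrow> 'a::topological_space) measure"
  assumes "borel_prob P"
  shows "(\<lambda>x. x j) \<in> borel_measurable P"
proof -
  have "(\<lambda>x :: nat \<Rightarrow> 'a. x j) \<in> borel_measurable borel"
    by (intro borel_measurable_continuous_onI continuous_on_product_coordinates)
  then show ?thesis
    using assms by (simp add: borel_prob_def cong: measurable_cong_sets)
qed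

lemma measurable_group_difference:
  fixes f g :: "'b \<Rightarrow> 'a::compact_group"
  assumes "f \<in> borel_measurable M" "g \<in> borel_measurable M"
  shows "(\<lambda>x. - f x + g x) \<in> borel_measurable M"
proof -
  have "continuous_on UNIV (uminus :: 'a \<Rightarrow> 'a)"
    unfolding continuous_on_def using tendsto_minus[OF tendsto_ident_at] by auto
  then have "(\<lambda>x. - f x) \<in> borel_measurable M"
    using assms(1) by (rule borel_measurable_continuous_on)
  then show ?thesis using assms(2) by (rule borel_measurable_add)
qed

lemma measurable_noise:
  fixes \<phi> :: "nat \<Rightarrow> 'a::compact_group \<Rightarrow> 'a"
  assumes "\<phi> k \<in> borel_measurable borel"
    "(\<lambda>x. x k) \<in> borel_measurable M" "(\<lambda>x. x (Suc k)) \<in> borel_measurable M"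
  shows "noise \<phi> k \<in> borel_measurable M"
  unfolding noise_def[abs_def]
  by (intro measurable_group_difference measurable_compose[OF assms(3) assms(1)] assms(2))

section \<open>Independence of the noise and the past\<close>

text \<open>Since \<open>X\<^sub>k\<close> is produced from \<open>X\<^sub>k\<^sub>+\<^sub>1\<close>, larger indices are earlier times: the past at time \<open>n\<close>
  consists of the coordinates with index at least \<open>n\<close>.\<close>

locale stochastic_equation =
  fixes \<phi> :: "nat \<Rightarrow> 'a::compact_group \<Rightarrow> 'a" and \<mu> :: "nat \<Rightarrow> 'a measure"
    and P :: "(nat \<Rightarrow> 'a) measure"
  assumes phi_measurable [measurable]: "\<And>k. \<phi> k \<in> borel_measurable borel"
    and mu: "\<And>k. borel_prob (\<mu> k)"
    and solution: "P \<in> solutions \<phi> \<mu>"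
begin

abbreviation past :: "nat \<Rightarrow> (nat \<Rightarrow> 'a) measure" where
  "past n \<equiv> sigma_family {n..} (\<lambda>j x. x j)"

abbreviation noise_before :: "nat \<Rightarrow> (nat \<Rightarrow> 'a) measure" where
  "noise_before n \<equiv> sigma_family {..<n} (noise \<phi>)"

lemma P_borel: "borel_prob P"
  using solution by (simp add: solutions_def)

sublocale prob_space P
  using P_borel by (simp add: borel_prob_def)

lemma space_P [simp]: "space P = UNIV"
  using P_borel sets_eq_imp_space_eq[of P borel] by (simp add: borel_prob_def)

lemma coordinate_measurable [measurable]: "(\<lambda>x. x j) \<in> borel_measurable P"
  by (rule borel_prob_measurable_coordinate[OF P_borel])

lemma noise_measurable [measurable]: "noise \<phi> k \<in> borel_measurable P"
  by (intro measurable_noise) measurable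

lemma subalgebra_past: "subalgebra P (past n)"
  by (intro subalgebra_sigma_family) auto

lemma subalgebra_noise: "subalgebra P (sigma_family J (noise \<phi>))"
  by (intro subalgebra_sigma_family) auto

lemma coordinate_measurable_past: "n \<le> j \<Longrightarrow> (\<lambda>x. x j) \<in> borel_measurable (past n)"
  by (rule measurable_sigma_family[where Y = "\<lambda>j x. x j"]) simp

lemma noise_measurable_past: "n \<le> k \<Longrightarrow> noise \<phi> k \<in> borel_measurable (past n)"
  by (intro measurable_noise coordinate_measurable_past) auto

lemma past_antimono: "m \<le> n \<Longrightarrow> sets (past n) \<subseteq> sets (past m)"
  by (intro sets_sigma_family_subset coordinate_measurable_past) auto

text \<open>The defining condition on conditional expectations, for indicator functions and integrated
  over an event of the past.\<close>

lemma emeasure_transition: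
  assumes "C \<in> sets (past (Suc k))" "E \<in> sets borel"
  shows "emeasure P (C \<inter> {x. x k \<in> E})
    = (\<integral>\<^sup>+x. indicator C x * emeasure (\<mu> k) {z. \<phi> k (x (Suc k)) + z \<in> E} \<partial>P)"
proof -
  interpret mu: prob_space "\<mu> k" using mu by (simp add: borel_prob_def)
  have sets_mu: "sets (\<mu> k) = sets borel" using mu by (simp add: borel_prob_def)
  have sp_mu: "space (\<mu> k) = UNIV" using sets_eq_imp_space_eq[OF sets_mu] by simp
  have past_eq: "past (Suc k) = sigma_family {k<..} (\<lambda>j x. x j)"
    by (simp add: greaterThan_Suc atLeast_Suc_greaterThan)
  interpret sub: finite_measure_subalgebra P "past (Suc k)"
    by unfold_locales (rule subalgebra_past)
  have C[measurable]: "C \<in> sets P"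
    using assms(1) subalgebra_past by (auto simp: subalgebra_def)
  note [measurable] = assms(2)
  let ?f = "indicator E :: 'a \<Rightarrow> real"
  let ?Q = "\<lambda>x. measure (\<mu> k) {z. \<phi> k (x (Suc k)) + z \<in> E}"
  have fint: "integrable P (\<lambda>x. ?f (x k))"
    by (rule integrable_const_bound[of _ 1]) (auto simp: indicator_def)
  have "AE x in P. real_cond_exp P (past (Suc k)) (\<lambda>x. ?f (x k)) x
      = (\<integral>z. ?f (\<phi> k (x (Suc k)) + z) \<partial>\<mu> k)"
  proof -
    have "bounded (range ?f)"
      by (auto simp: bounded_iff indicator_def intro!: exI[of _ 1])
    then show ?thesis
      using solution unfolding solutions_def past_eq by auto
  qed
  moreover have trans_meas: "(\<lambda>z. a + z) \<in> borel_measurable (\<mu> k)" for a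
    unfolding measurable_cong_sets[OF sets_mu refl] by measurable
  have "{z. a + z \<in> E} \<in> sets (\<mu> k)" for a
    using measurable_sets[OF trans_meas assms(2), of a] by (simp add: sp_mu vimage_def)
  then have "(\<integral>z. ?f (a + z) \<partial>\<mu> k) = measure (\<mu> k) {z. a + z \<in> E}" for a
  proof -
    have "(\<integral>z. ?f (a + z) \<partial>\<mu> k) = (\<integral>z. indicator {z. a + z \<in> E} z \<partial>\<mu> k)"
      by (intro Bochner_Integration.integral_cong) (auto simp: indicator_def)
    then show ?thesis by (simp add: sp_mu)
  qed
  ultimately have cond: "AE x in P. real_cond_exp P (past (Suc k)) (\<lambda>x. ?f (x k)) x = ?Q x"
    by simp
  have Qm: "(\<lambda>x. ?Q x) \<in> borel_measurable P"
  proof -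
    have "(\<lambda>(x, z). \<phi> k (x (Suc k)) + z) \<in> borel_measurable (P \<Otimes>\<^sub>M \<mu> k)"
    proof -
      have [measurable]: "snd \<in> borel_measurable (P \<Otimes>\<^sub>M \<mu> k)"
        using measurable_snd[of P "\<mu> k"] by (simp add: measurable_cong_sets[OF refl sets_mu])
      show ?thesis by (simp add: split_beta')
    qed
    from measurable_sets[OF this assms(2)]
    have "{p \<in> space (P \<Otimes>\<^sub>M \<mu> k). \<phi> k (fst p (Suc k)) + snd p \<in> E} \<in> sets (P \<Otimes>\<^sub>M \<mu> k)"
      by (simp add: vimage_def split_beta' Int_def conj_commute)
    from mu.measurable_emeasure_Pair[OF this]
    have "(\<lambda>x. emeasure (\<mu> k) {z. \<phi> k (x (Suc k)) + z \<in> E}) \<in> borel_measurable P"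
      by (simp add: space_pair_measure sp_mu vimage_def)
    then show ?thesis by (simp add: measure_def)
  qed
  have "measure P (C \<inter> {x. x k \<in> E}) = (\<integral>x\<in>C. ?f (x k) \<partial>P)"
  proof -
    have "{x \<in> space P. x k \<in> E} \<in> sets P" by measurable
    then have "C \<inter> {x. x k \<in> E} \<in> sets P" using C by auto
    then have "measure P (C \<inter> {x. x k \<in> E}) = (\<integral>x. indicator (C \<inter> {x. x k \<in> E}) x \<partial>P)"
      by simp
    also have "\<dots> = (\<integral>x\<in>C. ?f (x k) \<partial>P)"
      unfolding set_lebesgue_integral_def
      by (intro Bochner_Integration.integral_cong) (auto simp: indicator_def)
    finally show ?thesis .
  qed
  also have "\<dots> = (\<integral>x\<in>C. real_cond_exp P (past (Suc k)) (\<lambda>x. ?f (x k)) x \<partial>P)"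
    using fint assms(1) by (rule sub.real_cond_exp_intA)
  also have "\<dots> = (\<integral>x. indicator C x * ?Q x \<partial>P)"
    unfolding set_lebesgue_integral_def using cond Qm
    by (intro integral_cong_AE) auto
  finally have "emeasure P (C \<inter> {x. x k \<in> E}) = ennreal (\<integral>x. indicator C x * ?Q x \<partial>P)"
    by (simp add: emeasure_eq_measure)
  also have "\<dots> = (\<integral>\<^sup>+x. ennreal (indicator C x * ?Q x) \<partial>P)"
    using Qm by (intro nn_integral_eq_integral[symmetric] integrable_const_bound[of _ 1])
      (auto simp: indicator_def)
  also have "\<dots> = (\<integral>\<^sup>+x. indicator C x * emeasure (\<mu> k) {z. \<phi> k (x (Suc k)) + z \<in> E} \<partial>P)"
    by (intro nn_integral_cong) (auto simp: indicator_def mu.emeasure_eq_measure)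
  finally show ?thesis .
qed

text \<open>The condition on a solution concerns functions of \<open>X\<^sub>k\<close> alone, whereas \<open>Z\<^sub>k\<close> also involves
  \<open>X\<^sub>k\<^sub>+\<^sub>1\<close>. The transition formula identifies the joint law of \<open>(X\<^sub>k, X\<^sub>k\<^sub>+\<^sub>1)\<close> on the event \<open>C\<close>
  with that of \<open>(\<phi>\<^sub>k(X\<^sub>k\<^sub>+\<^sub>1) + z, X\<^sub>k\<^sub>+\<^sub>1)\<close>, where \<open>z\<close> is drawn independently from \<open>\<mu>\<^sub>k\<close>: the two
  agree on rectangles, hence everywhere. The difference map turns the second pair into \<open>z\<close>.\<close>

lemma noise_indep_past:
  assumes "C \<in> sets (past (Suc k))" "D \<in> sets borel"
  shows "emeasure P (C \<inter> {x. noise \<phi> k x \<in> D}) = emeasure (\<mu> k) D * emeasure P C"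
proof -
  interpret mu: prob_space "\<mu> k" using mu by (simp add: borel_prob_def)
  have sets_mu [measurable_cong]: "sets (\<mu> k) = sets borel" using mu by (simp add: borel_prob_def)
  have sp_mu: "space (\<mu> k) = UNIV" using sets_eq_imp_space_eq[OF sets_mu] by simp
  have C[measurable]: "C \<in> sets P"
    using assms(1) subalgebra_past by (auto simp: subalgebra_def)
  note [measurable] = assms(2)
  \<comment> \<open>\<open>PC\<close> is \<open>P\<close> restricted to \<open>C\<close>; \<open>\<nu>1\<close> and \<open>\<nu>2\<close> are the two joint laws.\<close>
  define PC where "PC = density P (indicator C)"
  have [measurable_cong]: "sets PC = sets P" by (simp add: PC_def)
  have [simp]: "space PC = UNIV" by (simp add: PC_def)
  have PC: "emeasure PC A = emeasure P (C \<inter> A)" if "A \<in> sets P" for A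
    unfolding PC_def using that
    by (subst emeasure_density) (auto simp: indicator_inter_arith[symmetric] Int_commute)
  let ?S = "borel \<Otimes>\<^sub>M borel :: ('a \<times> 'a) measure"
  define \<nu>1 where "\<nu>1 = distr PC ?S (\<lambda>x. (x k, x (Suc k)))"
  define \<nu>2 where "\<nu>2 = distr (PC \<Otimes>\<^sub>M \<mu> k) ?S (\<lambda>(x, z). (\<phi> k (x (Suc k)) + z, x (Suc k)))"
  have m1 [measurable]: "(\<lambda>x. (x k, x (Suc k))) \<in> measurable PC ?S"
    by measurable
  have m2 [measurable]: "(\<lambda>(x, z). (\<phi> k (x (Suc k)) + z, x (Suc k))) \<in> measurable (PC \<Otimes>\<^sub>M \<mu> k) ?S"
    by measurable
  have "\<nu>1 = \<nu>2"
  proof (rule measure_eqI_generator_eq[where A = "\<lambda>_. UNIV"])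
    show "Int_stable {a \<times> b | a b. a \<in> sets (borel :: 'a measure) \<and> b \<in> sets (borel :: 'a measure)}"
      by (rule Int_stable_pair_measure_generator)
    show "sets \<nu>1 = sigma_sets UNIV {a \<times> b | a b. a \<in> sets borel \<and> b \<in> sets borel}"
      "sets \<nu>2 = sigma_sets UNIV {a \<times> b | a b. a \<in> sets borel \<and> b \<in> sets borel}"
      by (simp_all add: \<nu>1_def \<nu>2_def sets_pair_measure)
    show "range (\<lambda>_ :: nat. UNIV) \<subseteq> {a \<times> b | a b. a \<in> sets (borel :: 'a measure) \<and> b \<in> sets (borel :: 'a measure)}"
      by (auto intro!: exI[of _ UNIV])
    have "emeasure \<nu>1 UNIV = emeasure PC UNIV"
      unfolding \<nu>1_def using sets.top[of ?S] by (subst emeasure_distr) (auto simp: space_pair_measure)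
    then show "emeasure \<nu>1 UNIV \<noteq> \<infinity>"
      by (simp add: PC[of UNIV, simplified] sets.top[of P, simplified])
  next
    fix X assume "X \<in> {a \<times> b | a b. a \<in> sets (borel :: 'a measure) \<and> b \<in> sets (borel :: 'a measure)}"
    then obtain E E' where X: "X = E \<times> E'" and [measurable]: "E \<in> sets borel" "E' \<in> sets borel"
      by blast
    have C': "C \<inter> {x. x (Suc k) \<in> E'} \<in> sets (past (Suc k))"
      using assms(1) measurable_sets[OF coordinate_measurable_past[of "Suc k" "Suc k"], of E']
      by (auto simp: vimage_def)
    have "emeasure \<nu>1 X = emeasure PC {x. x k \<in> E \<and> x (Suc k) \<in> E'}"
      unfolding \<nu>1_def X
      by (subst emeasure_distr) (auto simp: vimage_def intro!: arg_cong2[where f = emeasure])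
    also have "\<dots> = emeasure P ((C \<inter> {x. x (Suc k) \<in> E'}) \<inter> {x. x k \<in> E})"
    proof -
      have "{x \<in> space P. x k \<in> E \<and> x (Suc k) \<in> E'} \<in> sets P" by measurable
      then show ?thesis
        by (subst PC) (auto intro!: arg_cong2[where f = emeasure])
    qed
    also have "\<dots> = (\<integral>\<^sup>+x. indicator C x * (indicator E' (x (Suc k))
        * emeasure (\<mu> k) {z. \<phi> k (x (Suc k)) + z \<in> E}) \<partial>P)"
      unfolding emeasure_transition[OF C' \<open>E \<in> sets borel\<close>]
      by (intro nn_integral_cong) (auto simp: indicator_def)
    also have "\<dots> = emeasure \<nu>2 X"
    proof -
      have "emeasure \<nu>2 X
          = (\<integral>\<^sup>+x. emeasure (\<mu> k) (Pair x -` ((\<lambda>(x, z). (\<phi> k (x (Suc k)) + z, x (Suc k))) -` X \<inter> space (PC \<Otimes>\<^sub>M \<mu> k))) \<partial>PC)"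
      proof -
        have "X \<in> sets ?S" unfolding X by measurable
        from measurable_sets[OF m2 this] mu.emeasure_pair_measure_alt show ?thesis
          unfolding \<nu>2_def emeasure_distr[OF m2 \<open>X \<in> sets ?S\<close>] by blast
      qed
      also have "\<dots> = (\<integral>\<^sup>+x. indicator E' (x (Suc k))
          * emeasure (\<mu> k) {z. \<phi> k (x (Suc k)) + z \<in> E} \<partial>PC)"
        by (intro nn_integral_cong) (auto simp: X space_pair_measure sp_mu vimage_def indicator_def)
      also have "\<dots> = (\<integral>\<^sup>+x. indicator C x * (indicator E' (x (Suc k))
        * emeasure (\<mu> k) {z. \<phi> k (x (Suc k)) + z \<in> E}) \<partial>P)"
      proof -
        have "(\<lambda>x. emeasure (\<mu> k) (Pair x -` {p \<in> space (P \<Otimes>\<^sub>M \<mu> k). \<phi> k (fst p (Suc k)) + snd p \<in> E})) \<in> borel_measurable P"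
          by (intro mu.measurable_emeasure_Pair) measurable
        then have [measurable]: "(\<lambda>x. emeasure (\<mu> k) {z. \<phi> k (x (Suc k)) + z \<in> E}) \<in> borel_measurable P"
          by (simp add: space_pair_measure sp_mu vimage_def)
        show ?thesis
          unfolding PC_def by (subst nn_integral_density) auto
      qed
      finally show ?thesis by simp
    qed
    finally show "emeasure \<nu>1 X = emeasure \<nu>2 X" .
  qed auto
  moreover define U where "U = {p :: 'a \<times> 'a. - \<phi> k (snd p) + fst p \<in> D}"
  have U: "U \<in> sets ?S"
  proof -
    have "(\<lambda>p :: 'a \<times> 'a. - \<phi> k (snd p) + fst p) \<in> borel_measurable ?S"
      by (intro measurable_group_difference) measurable
    from measurable_sets[OF this assms(2)] show ?thesis
      by (simp add: U_def vimage_def space_pair_measure)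
  qed
  moreover have "emeasure \<nu>1 U = emeasure P (C \<inter> {x. noise \<phi> k x \<in> D})"
  proof -
    have "emeasure \<nu>1 U = emeasure PC {x. noise \<phi> k x \<in> D}"
      unfolding \<nu>1_def using U
      by (subst emeasure_distr) (auto simp: vimage_def U_def noise_def intro!: arg_cong2[where f = emeasure])
    moreover have "{x \<in> space P. noise \<phi> k x \<in> D} \<in> sets P" by measurable
    ultimately show ?thesis by (simp add: PC)
  qed
  moreover have "emeasure \<nu>2 U = emeasure (\<mu> k) D * emeasure P C"
  proof -
    have "emeasure \<nu>2 U = emeasure (PC \<Otimes>\<^sub>M \<mu> k) (UNIV \<times> D)"
      unfolding \<nu>2_def using U
      by (subst emeasure_distr)
        (auto simp: vimage_def U_def space_pair_measure sp_mu add.assoc[symmetric] intro!: arg_cong2[where f = emeasure])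
    also have "\<dots> = emeasure PC UNIV * emeasure (\<mu> k) D"
      using sets.top[of PC]
      by (intro mu.emeasure_pair_measure_Times) auto
    finally show ?thesis
      using sets.top[of P] by (simp add: PC mult.commute)
  qed
  ultimately show ?thesis by simp
qed

lemma distr_noise: "distr P borel (noise \<phi> k) = \<mu> k"
proof (rule measure_eqI)
  show "sets (distr P borel (noise \<phi> k)) = sets (\<mu> k)"
    using mu by (simp add: borel_prob_def)
  fix D assume "D \<in> sets (distr P borel (noise \<phi> k))"
  then have "D \<in> sets borel" by simp
  then show "emeasure (distr P borel (noise \<phi> k)) D = emeasure (\<mu> k) D"
    using noise_indep_past[of UNIV k D] sets.top[of "past (Suc k)"] emeasure_space_1
    by (simp add: emeasure_distr vimage_def)
qed

text \<open>Induction on \<open>n\<close>: the noise variable \<open>Z\<^sub>n\<close> belongs to the past at time \<open>n\<close>, from which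
  \<open>Z\<^sub>0, \<dots>, Z\<^sub>n\<^sub>-\<^sub>1\<close> are independent by hypothesis, and it is itself independent of the past at
  time \<open>n + 1\<close>. This gives the product formula on the \<open>\<pi>\<close>-system of intersections of an event of
  \<open>Z\<^sub>0, \<dots>, Z\<^sub>n\<^sub>-\<^sub>1\<close> with an event of \<open>Z\<^sub>n\<close>.\<close>

lemma indep_noise_before_past: "indep_set (sets (noise_before n)) (sets (past n))"
proof (induction n)
  case 0
  have "sets (noise_before 0) = {{}, UNIV}"
    by (simp add: sets_sigma_family sigma_sets_empty_eq)
  then show ?case
    using subalgebra_past[of 0] prob_space sets.top[of P]
    by (intro indep_setI) (auto simp: subalgebra_def)
next
  case (Suc n)
  define \<A> where "\<A> = {A \<inter> {x. noise \<phi> n x \<in> D} | A D. A \<in> sets (noise_before n) \<and> D \<in> sets borel}"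
  have D_past: "{x. noise \<phi> n x \<in> D} \<in> sets (past n)" if "D \<in> sets borel" for D
    using measurable_sets[OF noise_measurable_past[of n n] that] by (simp add: vimage_def)
  have past_P: "sets (past m) \<subseteq> sets P" for m
    using subalgebra_past by (auto simp: subalgebra_def)
  have before_P: "sets (noise_before m) \<subseteq> sets P" for m
    using subalgebra_noise by (auto simp: subalgebra_def)
  have "indep_set \<A> (sets (past (Suc n)))"
  proof (rule indep_setI)
    show "\<A> \<subseteq> events"
      using before_P[of n] past_P[of n] D_past by (auto simp: \<A>_def intro!: sets.Int)
    show "sets (past (Suc n)) \<subseteq> events" by (rule past_P)
    fix a C assume "a \<in> \<A>" and C: "C \<in> sets (past (Suc n))"
    then obtain A D where a: "a = A \<inter> {x. noise \<phi> n x \<in> D}"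
      and A: "A \<in> sets (noise_before n)" and D: "D \<in> sets borel"
      by (auto simp: \<A>_def)
    have C': "C \<in> sets (past n)" using C past_antimono[of n "Suc n"] by auto
    have CD: "prob (C \<inter> {x. noise \<phi> n x \<in> D}) = measure (\<mu> n) D * prob C"
      using noise_indep_past[OF C D] by (simp add: measure_def enn2real_mult)
    have "prob {x. noise \<phi> n x \<in> D} = measure (\<mu> n) D"
      using noise_indep_past[of UNIV n D] sets.top[of "past (Suc n)"] D prob_space
      by (simp add: measure_def enn2real_mult)
    then have 1: "prob a = prob A * measure (\<mu> n) D"
      unfolding a using indep_setD[OF Suc.IH A D_past[OF D]] by simp
    have "prob (a \<inter> C) = prob (A \<inter> (C \<inter> {x. noise \<phi> n x \<in> D}))"
      by (simp add: a Int_ac)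
    also have "\<dots> = prob A * prob (C \<inter> {x. noise \<phi> n x \<in> D})"
      using C' D_past[OF D] by (intro indep_setD[OF Suc.IH A]) auto
    finally show "prob (a \<inter> C) = prob a * prob C"
      by (simp add: CD 1)
  qed
  moreover have "Int_stable \<A>"
  proof (rule Int_stableI)
    fix a b assume "a \<in> \<A>" "b \<in> \<A>"
    then obtain A D A' D' where "a = A \<inter> {x. noise \<phi> n x \<in> D}" "b = A' \<inter> {x. noise \<phi> n x \<in> D'}"
      "A \<in> sets (noise_before n)" "D \<in> sets borel" "A' \<in> sets (noise_before n)" "D' \<in> sets borel"
      by (auto simp: \<A>_def)
    then show "a \<inter> b \<in> \<A>"
      unfolding \<A>_def by (intro CollectI exI[of _ "A \<inter> A'"] exI[of _ "D \<inter> D'"]) auto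
  qed
  ultimately have "indep_set (sigma_sets UNIV \<A>) (sigma_sets UNIV (sets (past (Suc n))))"
    using indep_set_sigma_sets[of \<A> "sets (past (Suc n))"] sets.Int_stable[of "past (Suc n)"] by simp
  moreover have "sigma_sets UNIV (sets (past (Suc n))) = sets (past (Suc n))"
    using sets.sigma_sets_eq[of "past (Suc n)"] by simp
  moreover have "sets (noise_before (Suc n)) \<subseteq> sigma_sets UNIV \<A>"
    unfolding sets_sigma_family
  proof (intro sigma_sets_mono subsetI)
    fix a assume "a \<in> (\<Union>j<Suc n. {noise \<phi> j -` D | D. D \<in> sets borel})"
    then obtain j D where j: "j < Suc n" and a: "a = noise \<phi> j -` D" and D: "D \<in> sets borel"
      by blast
    have "a \<in> \<A>"
    proof (cases "j = n")
      case True
      then show ?thesis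
        using D sets.top[of "noise_before n"]
        by (auto simp: \<A>_def a vimage_def intro!: exI[of _ UNIV] exI[of _ D])
    next
      case False
      then have "a \<in> sets (noise_before n)"
        using measurable_sets[OF measurable_sigma_family[of j "{..<n}" "noise \<phi>"] D] j by (simp add: a)
      then show ?thesis
        unfolding \<A>_def by (intro CollectI exI[of _ a] exI[of _ UNIV]) auto
    qed
    then show "a \<in> sigma_sets UNIV \<A>" by (rule sigma_sets.Basic)
  qed
  ultimately show ?case
    unfolding indep_sets2_eq by auto
qed

lemma indep_var_noise_before_past:
  assumes "f \<in> borel_measurable (noise_before n)" "g \<in> borel_measurable (past n)"
  shows "indep_var borel f borel g"
  unfolding indep_var_eq
proof (intro conjI)
  show f: "f \<in> borel_measurable P"
    using measurable_from_subalg[OF subalgebra_noise assms(1)] .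
  show g: "g \<in> borel_measurable P"
    using measurable_from_subalg[OF subalgebra_past assms(2)] .
  have "sigma_sets UNIV {f -` A \<inter> UNIV | A. A \<in> sets borel} \<subseteq> sets (noise_before n)"
    using measurable_sets[OF assms(1)] sets.sigma_sets_subset[of "{f -` A \<inter> UNIV | A. A \<in> sets borel}" "noise_before n"]
    by auto
  moreover have "sigma_sets UNIV {g -` A \<inter> UNIV | A. A \<in> sets borel} \<subseteq> sets (past n)"
    using measurable_sets[OF assms(2)] sets.sigma_sets_subset[of "{g -` A \<inter> UNIV | A. A \<in> sets borel}" "past n"]
    by auto
  moreover note indep_noise_before_past[of n]
  ultimately show "indep_set (sigma_sets (space P) {f -` A \<inter> space P | A. A \<in> sets borel})
      (sigma_sets (space P) {g -` A \<inter> space P | A. A \<in> sets borel})"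
    unfolding indep_sets2_eq space_P by (meson subsetD subset_trans)
qed

end

section \<open>Characters of the torus\<close>

lift_definition torus_char :: "int ^ 2 \<Rightarrow> torus \<Rightarrow> complex"
  is "\<lambda>m x. cis (2 * pi * (\<Sum>i\<in>UNIV. of_int (m $ i) * x $ i))"
proof -
  fix m :: "int ^ 2" and x y :: "real ^ 2" assume "int_lattice_rel x y"
  then have "(\<Sum>i\<in>UNIV. of_int (m $ i) * (x $ i - y $ i)) \<in> \<int>"
    by (intro Ints_sum Ints_mult) (auto simp: int_lattice_rel_def)
  then have "cis (2 * pi * (\<Sum>i\<in>UNIV. of_int (m $ i) * (x $ i - y $ i))) = 1"
    by (rule cis_multiple_2pi)
  then have "cis (2 * pi * (\<Sum>i\<in>UNIV. of_int (m $ i) * x $ i))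
      / cis (2 * pi * (\<Sum>i\<in>UNIV. of_int (m $ i) * y $ i)) = 1"
    by (simp add: cis_divide right_diff_distrib sum_subtractf)
  then show "cis (2 * pi * (\<Sum>i\<in>UNIV. of_int (m $ i) * x $ i))
      = cis (2 * pi * (\<Sum>i\<in>UNIV. of_int (m $ i) * y $ i))"
    by simp
qed

lemma norm_torus_char [simp]: "norm (torus_char m t) = 1"
  by transfer simp

lemma torus_char_add: "torus_char m (s + t) = torus_char m s * torus_char m t"
  by transfer (simp add: cis_mult distrib_left sum.distrib)

lemma torus_char_zero [simp]: "torus_char 0 t = 1"
  by transfer simp

lemma torus_char_mult_cnj: "torus_char m t * cnj (torus_char n t) = torus_char (m - n) t"
  by transfer (simp add: cis_cnj cis_mult left_diff_distrib sum_subtractf right_diff_distrib)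

lemma torus_char_toral_map: "torus_char m (toral_map S t) = torus_char (m v* S) t"
  by transfer
    (simp add: matrix_vector_mult_def vector_matrix_mult_def sum_2 map_matrix_def algebra_simps)

lemma torus_char_measurable: "torus_char m \<in> borel_measurable borel"
proof (intro borel_measurable_continuous_onI continuous_on_torus_lift)
  show "continuous_on UNIV (\<lambda>x. torus_char m (abs_torus x))"
    by (auto simp: torus_char.abs_eq intro!: continuous_intros)
qed

text \<open>Translation by \<open>a\<close> multiplies the integral by the value of the character at \<open>a\<close>, and some
  \<open>a\<close> has value \<open>-1\<close>.\<close>

lemma integral_torus_char:
  assumes "normalized_haar lam" "m \<noteq> 0"
  shows "(\<integral>t. torus_char m t \<partial>lam) = 0"
proof -
  have lam: "sets lam = sets borel" "\<And>a. distr lam borel (\<lambda>t. a + t) = lam"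
    using assms(1) by (auto simp: normalized_haar_def borel_prob_def)
  obtain j where j: "m $ j \<noteq> 0" using assms(2) by (auto simp: vec_eq_iff)
  define a where "a = abs_torus (axis j (1 / (2 * of_int (m $ j))))"
  have "(\<Sum>i\<in>UNIV. real_of_int (m $ i) * axis j (1 / (2 * of_int (m $ j))) $ i)
      = (\<Sum>i\<in>UNIV. if i = j then 1 / 2 else 0)"
    using j by (intro sum.cong) (auto simp: axis_def)
  also have "\<dots> = 1 / 2" by simp
  finally have a: "torus_char m a = -1"
    unfolding a_def torus_char.abs_eq by (simp only:) simp
  have "(\<lambda>t. a + t) \<in> measurable lam borel"
    unfolding measurable_cong_sets[OF lam(1) refl] by measurable
  then have "(\<integral>t. torus_char m t \<partial>distr lam borel (\<lambda>t. a + t)) = (\<integral>t. torus_char m (a + t) \<partial>lam)"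
    by (intro integral_distr torus_char_measurable)
  then have "(\<integral>t. torus_char m t \<partial>lam) = - (\<integral>t. torus_char m t \<partial>lam)"
    by (simp add: lam(2) torus_char_add a)
  then show ?thesis
    by (simp add: eq_neg_iff_add_eq_0 flip: mult_2)
qed

text \<open>Bessel's inequality for the orthonormal family of characters. The coefficient of \<open>f\<close> is taken
  against \<open>\<chi>\<close> and not against its conjugate, so the projection \<open>g\<close> in the proof uses the
  conjugate characters.\<close>

lemma bessel_torus_char:
  assumes haar: "normalized_haar lam" and f: "f \<in> borel_measurable borel"
    and K: "\<And>t. norm (f t :: complex) \<le> K" and "finite I"
  shows "(\<Sum>m\<in>I. (norm (\<integral>t. f t * torus_char m t \<partial>lam))\<^sup>2) \<le> (\<integral>t. (norm (f t))\<^sup>2 \<partial>lam)"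
proof -
  interpret prob_space lam using haar by (simp add: normalized_haar_def borel_prob_def)
  have [measurable_cong]: "sets lam = sets borel"
    using haar by (simp add: normalized_haar_def borel_prob_def)
  note [measurable] = f torus_char_measurable
  define c where "c m = (\<integral>t. f t * torus_char m t \<partial>lam)" for m
  define g where "g t = (\<Sum>m\<in>I. c m * cnj (torus_char m t))" for t
  have cnj_char: "cnj (torus_char m t) = torus_char (- m) t" for m t
    using torus_char_mult_cnj[of 0 t m] by simp
  have [measurable]: "g \<in> borel_measurable borel"
    unfolding g_def cnj_char by measurable
  have "0 \<le> K" using K[of 0] norm_ge_zero order_trans by blast
  have int_fc: "integrable lam (\<lambda>t. f t * torus_char m t)" for m
    by (rule integrable_const_bound[of _ K]) (auto simp: norm_mult K)
  have int_cc: "integrable lam (\<lambda>t. torus_char m t)" for m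
    by (rule integrable_const_bound[of _ 1]) auto
  have orth: "(\<integral>t. torus_char m t * cnj (torus_char n t) \<partial>lam) = (if m = n then 1 else 0)" for m n
    using integral_torus_char[OF haar, of "m - n"] by (simp add: torus_char_mult_cnj prob_space)
  have fg: "(\<integral>t. f t * cnj (g t) \<partial>lam) = of_real (\<Sum>m\<in>I. (norm (c m))\<^sup>2)"
    and int_fg: "integrable lam (\<lambda>t. f t * cnj (g t))"
  proof -
    have eq: "f t * cnj (g t) = (\<Sum>m\<in>I. cnj (c m) * (f t * torus_char m t))" for t
      by (simp add: g_def sum_distrib_left algebra_simps)
    show "integrable lam (\<lambda>t. f t * cnj (g t))"
      unfolding eq by (intro Bochner_Integration.integrable_sum integrable_mult_right int_fc)
    have "(\<integral>t. f t * cnj (g t) \<partial>lam) = (\<Sum>m\<in>I. cnj (c m) * c m)"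
      unfolding eq by (subst Bochner_Integration.integral_sum) (auto simp: int_fc c_def)
    then show "(\<integral>t. f t * cnj (g t) \<partial>lam) = of_real (\<Sum>m\<in>I. (norm (c m))\<^sup>2)"
      by (simp add: complex_norm_square mult.commute del: of_real_power)
  qed
  have gg: "(\<integral>t. g t * cnj (g t) \<partial>lam) = of_real (\<Sum>m\<in>I. (norm (c m))\<^sup>2)"
    and int_gg: "integrable lam (\<lambda>t. g t * cnj (g t))"
  proof -
    have eq: "g t * cnj (g t)
        = (\<Sum>m\<in>I. \<Sum>n\<in>I. (c m * cnj (c n)) * (torus_char n t * cnj (torus_char m t)))" for t
      by (simp add: g_def sum_distrib_left sum_distrib_right algebra_simps) (rule sum.swap)
    have int: "integrable lam (\<lambda>t. (c m * cnj (c n)) * (torus_char n t * cnj (torus_char m t)))" for m n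
      unfolding torus_char_mult_cnj by (intro integrable_mult_right int_cc)
    show "integrable lam (\<lambda>t. g t * cnj (g t))"
      unfolding eq by (intro Bochner_Integration.integrable_sum int)
    have "(\<integral>t. g t * cnj (g t) \<partial>lam) = (\<Sum>m\<in>I. \<Sum>n\<in>I. (c m * cnj (c n)) * (if n = m then 1 else 0))"
      unfolding eq using int orth
      by (simp add: Bochner_Integration.integral_sum Bochner_Integration.integrable_sum del: integral_mult_left integral_mult_right)
    also have "\<dots> = (\<Sum>m\<in>I. c m * cnj (c m))"
      using \<open>finite I\<close> by (intro sum.cong refl) (simp add: if_distrib[of "(*) _"] cong: if_cong)
    finally show "(\<integral>t. g t * cnj (g t) \<partial>lam) = of_real (\<Sum>m\<in>I. (norm (c m))\<^sup>2)"
      by (simp add: complex_norm_square del: of_real_power)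
  qed
  have int_ff: "integrable lam (\<lambda>t. (norm (f t))\<^sup>2)"
    by (rule integrable_const_bound[of _ "K\<^sup>2"]) (auto simp: K intro!: power_mono)
  have "0 \<le> (\<integral>t. (norm (f t - g t))\<^sup>2 \<partial>lam)"
    by simp
  also have "(\<lambda>t. (norm (f t - g t))\<^sup>2)
      = (\<lambda>t. (norm (f t))\<^sup>2 - 2 * Re (f t * cnj (g t)) + Re (g t * cnj (g t)))"
    unfolding cmod_power2 by (simp add: fun_eq_iff power2_eq_square algebra_simps)
  also have "(\<integral>t. (norm (f t))\<^sup>2 - 2 * Re (f t * cnj (g t)) + Re (g t * cnj (g t)) \<partial>lam)
      = (\<integral>t. (norm (f t))\<^sup>2 \<partial>lam) - 2 * Re (\<integral>t. f t * cnj (g t) \<partial>lam) + Re (\<integral>t. g t * cnj (g t) \<partial>lam)"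
    using int_ff integrable_Re[OF int_fg] integrable_Re[OF int_gg]
    by (simp only: Bochner_Integration.integral_add Bochner_Integration.integral_diff
        Bochner_Integration.integrable_diff integrable_mult_right integral_mult_right_zero
        integral_Re[OF int_fg] integral_Re[OF int_gg])
  finally show ?thesis
    by (simp add: fg gg c_def)
qed

lemma riemann_lebesgue_torus:
  assumes "normalized_haar lam" "f \<in> borel_measurable borel" "\<And>t. norm (f t :: complex) \<le> K"
    and "inj (m :: nat \<Rightarrow> int ^ 2)"
  shows "(\<lambda>n. \<integral>t. f t * torus_char (m n) t \<partial>lam) \<longlonglongrightarrow> 0"
proof -
  let ?a = "\<lambda>n. (norm (\<integral>t. f t * torus_char (m n) t \<partial>lam))\<^sup>2"
  have "sum ?a {..<N} \<le> (\<integral>t. (norm (f t))\<^sup>2 \<partial>lam)" for N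
    using bessel_torus_char[OF assms(1-3), of "m ` {..<N}"] assms(4)
    by (simp add: sum.reindex inj_on_subset)
  then have "summable ?a"
    by (intro summableI_nonneg_bounded) auto
  then have "?a \<longlonglongrightarrow> 0"
    by (rule summable_LIMSEQ_zero)
  from tendsto_real_sqrt[OF this] show ?thesis
    by (simp add: tendsto_norm_zero_iff)
qed

section \<open>The orbit of a frequency under an ergodic matrix\<close>

text \<open>The eigenvalues are the roots of \<open>z\<^sup>2 - t z + 1\<close> with \<open>t\<close> the trace. For \<open>\<bar>t\<bar> \<le> 2\<close> they are
  complex conjugates with product 1, hence of modulus 1. If \<open>S\<close> is lower triangular, its
  diagonal entries are integers with product 1, so they are eigenvalues of modulus 1 too.\<close>

lemma ergodic_toral_matrix_entries:
  assumes "ergodic_toral_matrix S"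
  shows "S $ 1 $ 2 \<noteq> 0" "2 < \<bar>S $ 1 $ 1 + S $ 2 $ 2\<bar>"
proof -
  define a b c d where "a = S $ 1 $ 1" "b = S $ 1 $ 2" "c = S $ 2 $ 1" "d = S $ 2 $ 2"
  have det: "a * d - b * c = 1"
    using assms by (simp add: ergodic_toral_matrix_def det_2 a_b_c_d_def mult.commute)
  have no_ev: "\<not> complex_eigenvalue S z" if "cmod z = 1" for z
    using assms that by (auto simp: ergodic_toral_matrix_def)
  have ev: "complex_eigenvalue S z"
    if "v1 \<noteq> 0 \<or> v2 \<noteq> 0" "of_int a * v1 + of_int b * v2 = z * v1" "of_int c * v1 + of_int d * v2 = z * v2"
    for z v1 v2 :: complex
    unfolding complex_eigenvalue_def
    using that by (intro exI[of _ "vector [v1, v2]"])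
      (auto simp: vec_eq_iff forall_2 matrix_vector_mult_def sum_2 map_matrix_def a_b_c_d_def)
  show b: "S $ 1 $ 2 \<noteq> 0"
  proof
    assume "S $ 1 $ 2 = 0"
    then have "b = 0" by (simp add: a_b_c_d_def)
    then have "\<bar>d\<bar> = 1" using det by (metis abs_zmult_eq_1 diff_zero mult.commute mult_zero_left abs_1)
    moreover have "complex_eigenvalue S (of_int d)"
      using \<open>b = 0\<close> by (intro ev[of 0 1]) auto
    ultimately show False using no_ev[of "of_int d"] by (simp flip: of_int_abs)
  qed
  show "2 < \<bar>S $ 1 $ 1 + S $ 2 $ 2\<bar>"
  proof (rule ccontr)
    assume "\<not> 2 < \<bar>S $ 1 $ 1 + S $ 2 $ 2\<bar>"
    then have "\<bar>a + d\<bar> \<le> 2" by (simp add: a_b_c_d_def)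
    define t where "t = real_of_int (a + d)"
    have "t\<^sup>2 \<le> 4"
      using \<open>\<bar>a + d\<bar> \<le> 2\<close> power_mono[of "\<bar>t\<bar>" 2 2] unfolding t_def
      by (simp flip: of_int_abs)
    define z where "z = Complex (t / 2) (sqrt (4 - t\<^sup>2) / 2)"
    have "(cmod z)\<^sup>2 = 1"
      using \<open>t\<^sup>2 \<le> 4\<close> by (simp add: z_def cmod_power2 power_divide flip: add_divide_distrib)
    then have z1: "cmod z = 1" using norm_ge_zero[of z] by (auto simp: power2_eq_1_iff)
    have "z * z - of_real t * z + 1 = 0"
      using \<open>t\<^sup>2 \<le> 4\<close> by (simp add: z_def complex_eq_iff power2_eq_square field_simps)
    then have zz: "z * z = (of_int a + of_int d) * z - 1"
      by (simp add: t_def algebra_simps eq_diff_eq)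
    have det': "of_int c * of_int b = of_int a * of_int d - (1 :: complex)"
      using arg_cong[OF det, of "of_int :: int \<Rightarrow> complex"] by (simp add: algebra_simps)
    \<comment> \<open>The vector \<open>(b, z - a)\<close> solves the first eigenvector equation for every \<open>z\<close> and the second one by the characteristic equation.\<close>
    have "complex_eigenvalue S z"
    proof (rule ev[of "of_int b" "z - of_int a"])
      show "of_int b \<noteq> (0 :: complex) \<or> z - of_int a \<noteq> 0"
        using b by (simp add: a_b_c_d_def)
      show "of_int c * of_int b + of_int d * (z - of_int a) = z * (z - of_int a)"
        unfolding det' using zz by (simp add: algebra_simps)
    qed (simp add: algebra_simps)
    with no_ev[OF z1] show False by blast
  qed
qed

text \<open>By the Cayley--Hamilton theorem the second coordinates satisfy
  \<open>q\<^sub>n\<^sub>+\<^sub>2 = t q\<^sub>n\<^sub>+\<^sub>1 - q\<^sub>n\<close> with \<open>\<bar>t\<bar> \<ge> 3\<close>, and they start with \<open>q\<^sub>0 = 0\<close> and \<open>q\<^sub>1 \<noteq> 0\<close>.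
  Therefore their absolute values increase strictly.\<close>

lemma inj_toral_frequencies:
  assumes "ergodic_toral_matrix S"
  shows "inj (\<lambda>n. ((\<lambda>m. m v* S) ^^ n) (axis 1 1))"
proof -
  define q where "q n = ((\<lambda>m. m v* S) ^^ n) (axis 1 1)" for n
  have q_Suc: "q (Suc n) = q n v* S" for n
    by (simp add: q_def)
  have rec: "q (Suc (Suc n)) $ 2 = (S $ 1 $ 1 + S $ 2 $ 2) * q (Suc n) $ 2 - q n $ 2" for n
  proof -
    have "S $ 1 $ 1 * S $ 2 $ 2 - S $ 1 $ 2 * S $ 2 $ 1 = 1"
      using assms by (simp add: ergodic_toral_matrix_def det_2)
    then have "q n $ 2 * (S $ 1 $ 1 * S $ 2 $ 2 - S $ 1 $ 2 * S $ 2 $ 1) = q n $ 2"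
      by simp
    then show ?thesis
      unfolding q_Suc by (simp add: vector_matrix_mult_def sum_2 algebra_simps)
  qed
  have step: "\<bar>q n $ 2\<bar> < \<bar>q (Suc n) $ 2\<bar>" for n
  proof (induction n)
    case 0
    then show ?case
      using ergodic_toral_matrix_entries(1)[OF assms] unfolding q_Suc
      by (simp add: q_def vector_matrix_mult_def sum_2 axis_def)
  next
    case (Suc n)
    have "3 * \<bar>q (Suc n) $ 2\<bar> \<le> \<bar>S $ 1 $ 1 + S $ 2 $ 2\<bar> * \<bar>q (Suc n) $ 2\<bar>"
      using ergodic_toral_matrix_entries(2)[OF assms] by (intro mult_right_mono) auto
    also have "\<dots> \<le> \<bar>q (Suc (Suc n)) $ 2\<bar> + \<bar>q n $ 2\<bar>"
      unfolding rec by (simp flip: abs_mult)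
    finally show ?case using Suc by linarith
  qed
  then have "strict_mono (\<lambda>n. \<bar>q n $ 2\<bar>)"
    by (simp add: strict_mono_Suc_iff)
  then have "inj (\<lambda>n. \<bar>q n $ 2\<bar>)"
    by (rule strict_mono_imp_inj_on)
  then show ?thesis
    unfolding q_def inj_def by metis
qed

section \<open>Toral equations have no strong solutions\<close>

text \<open>The frequency \<open>m\<close> of the starting character is a parameter, so that the frequencies of the
  characters \<open>\<chi> \<circ> S\<^sup>n\<close> can be named.\<close>

locale toral_stochastic_equation = stochastic_equation "\<lambda>_. toral_map S" "\<lambda>_. \<mu>s" P
  for S :: "int ^ 2 ^ 2" and \<mu>s :: "torus measure" and P :: "(nat \<Rightarrow> torus) measure" +
  fixes m :: "int ^ 2"
begin

definition freq :: "nat \<Rightarrow> int ^ 2" where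
  "freq n = ((\<lambda>m. m v* S) ^^ n) m"

lemma torus_char_unroll_step:
  "torus_char (freq n) (x n)
    = torus_char (freq (Suc n)) (x (Suc n)) * torus_char (freq n) (noise (\<lambda>_. toral_map S) n x)"
proof -
  have "x n = toral_map S (x (Suc n)) + noise (\<lambda>_. toral_map S) n x"
    by (simp add: noise_def)
  then have "torus_char (freq n) (x n)
      = torus_char (freq n) (toral_map S (x (Suc n)) + noise (\<lambda>_. toral_map S) n x)"
    by (rule arg_cong)
  then show ?thesis
    by (simp only: torus_char_add torus_char_toral_map freq_def funpow.simps o_apply)
qed

lemma torus_char_unroll:
  "torus_char m (x 0)
    = (\<Prod>k<n. torus_char (freq k) (noise (\<lambda>_. toral_map S) k x)) * torus_char (freq n) (x n)"
proof (induction n)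
  case 0
  show ?case by (simp add: freq_def)
next
  case (Suc n)
  then show ?case by (subst (asm) torus_char_unroll_step[of n]) (simp add: ac_simps)
qed

text \<open>The character of \<open>X\<^sub>n\<close> splits into independent factors for \<open>Z\<^sub>n\<close> and \<open>X\<^sub>n\<^sub>+\<^sub>1\<close>.\<close>

lemma norm_integral_char_coordinate_le:
  "norm (\<integral>x. torus_char (freq n) (x n) \<partial>P) \<le> norm (\<integral>z. torus_char (freq n) z \<partial>\<mu>s)"
proof -
  note [measurable] = torus_char_measurable
  have "indep_var borel (\<lambda>x. torus_char (freq n) (noise (\<lambda>_. toral_map S) n x))
      borel (\<lambda>x. torus_char (freq (Suc n)) (x (Suc n)))"
    by (intro indep_var_noise_before_past[where n = "Suc n"]
        measurable_compose[OF measurable_sigma_family torus_char_measurable]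
        measurable_compose[OF coordinate_measurable_past torus_char_measurable]) auto
  from indep_var_lebesgue_integral[OF this]
  have "(\<integral>x. torus_char (freq n) (x n) \<partial>P)
      = (\<integral>x. torus_char (freq n) (noise (\<lambda>_. toral_map S) n x) \<partial>P)
        * (\<integral>x. torus_char (freq (Suc n)) (x (Suc n)) \<partial>P)"
    by (subst torus_char_unroll_step) (simp add: mult.commute integrable_const_bound[of _ 1])
  also have "(\<integral>x. torus_char (freq n) (noise (\<lambda>_. toral_map S) n x) \<partial>P) = (\<integral>z. torus_char (freq n) z \<partial>\<mu>s)"
    by (subst distr_noise[of n, symmetric], subst integral_distr) auto
  finally have "norm (\<integral>x. torus_char (freq n) (x n) \<partial>P)
      = norm (\<integral>z. torus_char (freq n) z \<partial>\<mu>s) * norm (\<integral>x. torus_char (freq (Suc n)) (x (Suc n)) \<partial>P)"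
    by (simp add: norm_mult)
  moreover have "norm (\<integral>x. torus_char (freq (Suc n)) (x (Suc n)) \<partial>P) \<le> 1"
    using integral_norm_bound[of P "\<lambda>x. torus_char (freq (Suc n)) (x (Suc n))"] prob_space by simp
  ultimately show ?thesis
    by (simp add: mult_left_le)
qed

text \<open>In the expansion of \<open>\<chi>(X\<^sub>0)\<close>, the event and the product over \<open>Z\<^sub>0, \<dots>, Z\<^sub>n\<^sub>-\<^sub>1\<close> together are
  independent of the remaining factor \<open>\<chi>\<^sub>n(X\<^sub>n)\<close>.\<close>

lemma norm_integral_char_noise_before_le:
  assumes A: "A \<in> sets (noise_before n)"
  shows "norm (\<integral>x. indicator A x *\<^sub>R torus_char m (x 0) \<partial>P)
    \<le> norm (\<integral>z. torus_char (freq n) z \<partial>\<mu>s) * prob A"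
proof -
  note [measurable] = torus_char_measurable
  define f where "f x = indicator A x *\<^sub>R (\<Prod>k<n. torus_char (freq k) (noise (\<lambda>_. toral_map S) k x))" for x
  have A_P [measurable]: "A \<in> sets P"
    using A subalgebra_noise by (auto simp: subalgebra_def)
  have f: "f \<in> borel_measurable (noise_before n)"
    unfolding f_def[abs_def] using A
    by (intro borel_measurable_scaleR borel_measurable_indicator borel_measurable_prod
        measurable_compose[OF measurable_sigma_family torus_char_measurable]) auto
  have [measurable]: "f \<in> borel_measurable P"
    using measurable_from_subalg[OF subalgebra_noise f] .
  have norm_f: "norm (f x) = indicator A x" for x
    by (simp add: f_def prod_norm[symmetric])
  have "indep_var borel f borel (\<lambda>x. torus_char (freq n) (x n))"
    by (intro indep_var_noise_before_past[where n = n] f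
        measurable_compose[OF coordinate_measurable_past torus_char_measurable]) auto
  from indep_var_lebesgue_integral[OF this]
  have "(\<integral>x. f x * torus_char (freq n) (x n) \<partial>P) = (\<integral>x. f x \<partial>P) * (\<integral>x. torus_char (freq n) (x n) \<partial>P)"
    by (simp add: integrable_const_bound[of _ 1] norm_f indicator_def)
  moreover have "(\<lambda>x. indicator A x *\<^sub>R torus_char m (x 0)) = (\<lambda>x. f x * torus_char (freq n) (x n))"
    by (subst torus_char_unroll[of _ n]) (simp add: f_def)
  ultimately have "norm (\<integral>x. indicator A x *\<^sub>R torus_char m (x 0) \<partial>P)
      = norm (\<integral>x. f x \<partial>P) * norm (\<integral>x. torus_char (freq n) (x n) \<partial>P)"
    by (simp add: norm_mult)
  moreover have "norm (\<integral>x. f x \<partial>P) \<le> prob A"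
    using integral_norm_bound[of P f] by (simp add: norm_f)
  ultimately show ?thesis
    using norm_integral_char_coordinate_le[of n]
    by (metis mult.commute mult_mono measure_nonneg norm_ge_zero)
qed

text \<open>Both sides of the bound are continuous in \<open>A\<close> with respect to the distance
  \<open>P(A \<Delta> A')\<close>, and the bound holds on the algebra of events that depend on finitely many noise
  variables.\<close>

lemma norm_integral_char_noise_le:
  assumes c: "\<And>n. N \<le> n \<Longrightarrow> norm (\<integral>z. torus_char (freq n) z \<partial>\<mu>s) \<le> c" and "c \<le> 1"
    and A: "A \<in> sets (sigma_family UNIV (noise (\<lambda>_. toral_map S)))"
  shows "norm (\<integral>x. indicator A x *\<^sub>R torus_char m (x 0) \<partial>P) \<le> c * prob A"
proof -
  note [measurable] = torus_char_measurable
  define \<A> where "\<A> = (\<Union>n. sets (noise_before n))"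
  have before_mono: "sets (noise_before j) \<subseteq> sets (noise_before k)" if "j \<le> k" for j k
    using that by (intro sets_sigma_family_subset measurable_sigma_family) auto
  have before_P: "sets (noise_before n) \<subseteq> sets P" for n
    using subalgebra_noise by (auto simp: subalgebra_def)
  have "algebra UNIV \<A>"
    unfolding algebra_iff_Un
  proof (intro conjI ballI)
    fix a b assume "a \<in> \<A>" "b \<in> \<A>"
    then obtain j k where "a \<in> sets (noise_before j)" "b \<in> sets (noise_before k)"
      by (auto simp: \<A>_def)
    then have "a \<union> b \<in> sets (noise_before (max j k))"
      using before_mono[of j "max j k"] before_mono[of k "max j k"] by (intro sets.Un) auto
    then show "a \<union> b \<in> \<A>" by (auto simp: \<A>_def)
  next
    fix a assume "a \<in> \<A>"
    then obtain j where "a \<in> sets (noise_before j)" by (auto simp: \<A>_def)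
    then have "UNIV - a \<in> sets (noise_before j)"
      using sets.compl_sets by fastforce
    then show "UNIV - a \<in> \<A>" by (auto simp: \<A>_def)
  qed (auto simp: \<A>_def)
  moreover have "\<A> \<subseteq> sets P"
    using before_P by (auto simp: \<A>_def)
  moreover have "A \<in> sigma_sets UNIV \<A>"
  proof -
    have "noise (\<lambda>_. toral_map S) j -` D \<in> \<A>" if "D \<in> sets borel" for j D
      using measurable_sets[OF measurable_sigma_family[of j "{..<Suc j}" "noise (\<lambda>_. toral_map S)"] that]
      by (auto simp: \<A>_def)
    then have "sets (sigma_family UNIV (noise (\<lambda>_. toral_map S))) \<subseteq> sigma_sets UNIV \<A>"
      unfolding sets_sigma_family by (intro sigma_sets_mono') auto
    then show ?thesis using A by blast
  qed
  ultimately have approx: "\<exists>A'\<in>\<A>. prob (sym_diff A A') < \<delta>" if "0 < \<delta>" for \<delta>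
    using measure_sym_diff_approx[of \<A> A \<delta>] that by simp
  have A_P [measurable]: "A \<in> sets P"
    using A subalgebra_noise by (auto simp: subalgebra_def)
  have "norm (\<integral>x. indicator A x *\<^sub>R torus_char m (x 0) \<partial>P) \<le> c * prob A + e" if "0 < e" for e
  proof -
    obtain A' n0 where A': "A' \<in> sets (noise_before n0)" "prob (sym_diff A A') < e / 2"
      using approx[of "e / 2"] \<open>0 < e\<close> by (auto simp: \<A>_def)
    \<comment> \<open>The bound by \<open>c\<close> is available only from \<open>N\<close> on, and \<open>A'\<close> also depends on the first \<open>n\<close> noise variables.\<close>
    define n where "n = max n0 N"
    have A'_n: "A' \<in> sets (noise_before n)"
      using A'(1) before_mono[of n0 n] by (auto simp: n_def)
    have A'_P [measurable]: "A' \<in> sets P" using A'(1) before_P by blast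
    have int: "integrable P (\<lambda>x. indicator B x *\<^sub>R torus_char m (x 0))" if [measurable]: "B \<in> sets P" for B
      by (rule integrable_const_bound[of _ 1]) (auto simp: indicator_def)
    have "norm ((\<integral>x. indicator A x *\<^sub>R torus_char m (x 0) \<partial>P) - (\<integral>x. indicator A' x *\<^sub>R torus_char m (x 0) \<partial>P))
        = norm (\<integral>x. indicator A x *\<^sub>R torus_char m (x 0) - indicator A' x *\<^sub>R torus_char m (x 0) \<partial>P)"
      by (subst Bochner_Integration.integral_diff[OF int int]) auto
    also have "\<dots> \<le> (\<integral>x. norm (indicator A x *\<^sub>R torus_char m (x 0) - indicator A' x *\<^sub>R torus_char m (x 0)) \<partial>P)"
      by (rule integral_norm_bound)
    also have "\<dots> = (\<integral>x. indicator (sym_diff A A') x \<partial>P)"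
      by (intro Bochner_Integration.integral_cong) (auto simp: indicator_def)
    also have "\<dots> = prob (sym_diff A A')"
      by simp
    finally have 1: "norm (\<integral>x. indicator A x *\<^sub>R torus_char m (x 0) \<partial>P)
        \<le> norm (\<integral>x. indicator A' x *\<^sub>R torus_char m (x 0) \<partial>P) + e / 2"
      using A'(2) norm_triangle_sub[of "\<integral>x. indicator A x *\<^sub>R torus_char m (x 0) \<partial>P"
          "\<integral>x. indicator A' x *\<^sub>R torus_char m (x 0) \<partial>P"] by linarith
    have "0 \<le> c" using c[of N] norm_ge_zero order_trans by blast
    have "norm (\<integral>x. indicator A' x *\<^sub>R torus_char m (x 0) \<partial>P) \<le> c * prob A'"
      using norm_integral_char_noise_before_le[OF A'_n] c[of n]
        mult_right_mono[of "norm (\<integral>z. torus_char (freq n) z \<partial>\<mu>s)" c "prob A'"]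
      by (simp add: n_def)
    also have "prob A' \<le> prob A + prob (sym_diff A A')"
    proof -
      have "prob A' \<le> prob (A \<union> sym_diff A A')"
        by (intro finite_measure_mono) auto
      also have "\<dots> \<le> prob A + prob (sym_diff A A')"
        by (intro measure_Un_le) auto
      finally show ?thesis .
    qed
    then have "c * prob A' \<le> c * (prob A + prob (sym_diff A A'))"
      using \<open>0 \<le> c\<close> by (rule mult_left_mono)
    also have "\<dots> \<le> c * prob A + e / 2"
      using mult_right_mono[OF \<open>c \<le> 1\<close>, of "prob (sym_diff A A')"] A'(2)
      by (simp add: distrib_left)
    finally show ?thesis using 1 by simp
  qed
  then show ?thesis by (rule field_le_epsilon)
qed

lemma not_strong_if_coefficients_bounded:
  assumes "\<And>n. N \<le> n \<Longrightarrow> norm (\<integral>z. torus_char (freq n) z \<partial>\<mu>s) \<le> c" and "c < 1"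
  shows "P \<notin> strong_solutions (\<lambda>_. toral_map S) (\<lambda>_. \<mu>s)"
proof
  note [measurable] = torus_char_measurable
  let ?Z = "sigma_family UNIV (noise (\<lambda>_. toral_map S))"
  assume "P \<in> strong_solutions (\<lambda>_. toral_map S) (\<lambda>_. \<mu>s)"
  then have "\<exists>Y \<in> borel_measurable (sigma_family {0..} (noise (\<lambda>_. toral_map S))). AE x in P. x 0 = Y x"
    unfolding strong_solutions_def by blast
  then obtain Y where Y: "Y \<in> borel_measurable ?Z" "AE x in P. x 0 = Y x"
    unfolding atLeast_0 by blast
  have Y_P [measurable]: "Y \<in> borel_measurable P"
    using measurable_from_subalg[OF subalgebra_noise Y(1)] .
  have "1 \<le> c"
  proof (rule unimodular_set_integral_bound)
    show "subalgebra P ?Z" by (rule subalgebra_noise)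
    show "(\<lambda>x. torus_char m (Y x)) \<in> borel_measurable ?Z"
      using Y(1) torus_char_measurable by (rule measurable_compose)
    fix A assume A: "A \<in> sets ?Z"
    then have [measurable]: "A \<in> sets P"
      using subalgebra_noise by (auto simp: subalgebra_def)
    have "(\<integral>x. indicator A x *\<^sub>R torus_char m (Y x) \<partial>P) = (\<integral>x. indicator A x *\<^sub>R torus_char m (x 0) \<partial>P)"
      using Y(2) by (intro integral_cong_AE) auto
    then show "norm (\<integral>x. indicator A x *\<^sub>R torus_char m (Y x) \<partial>P) \<le> c * prob A"
      using norm_integral_char_noise_le[OF assms(1) _ A] \<open>c < 1\<close> by simp
  qed simp
  with \<open>c < 1\<close> show False by simp
qed

end

theorem theorem6p2:
  fixes S :: "int ^ 2 ^ 2" and \<mu>s lam :: "torus measure" and B :: "torus set" and \<epsilon> :: real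
  assumes "ergodic_toral_matrix S"
    and "borel_prob \<mu>s"
    and "normalized_haar lam"
    and "B \<in> sets borel" and "measure lam B > 0"
    and "\<epsilon> > 0"
    and "\<And>A. A \<in> sets borel \<Longrightarrow> measure \<mu>s A \<ge> \<epsilon> * measure lam (A \<inter> B)"
  shows "strong_solutions (\<lambda>_. toral_map S) (\<lambda>_. \<mu>s) = {}"
proof (rule equals0I)
  fix P assume P: "P \<in> strong_solutions (\<lambda>_. toral_map S) (\<lambda>_. \<mu>s)"
  interpret mu: prob_space \<mu>s using assms(2) by (simp add: borel_prob_def)
  \<comment> \<open>The frequency vector \<open>axis 1 1\<close> is one whose orbit under \<open>S\<close> is known to be injective.\<close>
  interpret toral_stochastic_equation S \<mu>s P "axis 1 1"
  proof unfold_locales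
    show "toral_map S \<in> borel_measurable borel"
      by (intro borel_measurable_continuous_onI continuous_toral_map)
  qed (use assms(2) P in \<open>auto simp: strong_solutions_def\<close>)
  have sets_mu: "sets \<mu>s = sets borel" and sets_lam: "sets lam = sets borel" and lam: "prob_space lam"
    using assms(2,3) by (auto simp: borel_prob_def normalized_haar_def)
  define b where "b n = norm (\<integral>t. indicator B t *\<^sub>R torus_char (freq n) t \<partial>lam)" for n
  have "(\<lambda>n. \<integral>t. of_real (indicator B t) * torus_char (freq n) t \<partial>lam) \<longlonglongrightarrow> 0"
  proof (rule riemann_lebesgue_torus[OF assms(3), where K = 1])
    show "(\<lambda>t. complex_of_real (indicator B t)) \<in> borel_measurable borel"
      using assms(4) by measurable
    show "inj freq"
      using inj_toral_frequencies[OF assms(1)] by (simp add: freq_def[abs_def])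
  qed (simp add: indicator_def)
  then have "b \<longlonglongrightarrow> 0"
    unfolding b_def[abs_def] scaleR_conv_of_real by (rule tendsto_norm_zero)
  then have "\<forall>\<^sub>F n in sequentially. b n < measure lam B / 2"
    using assms(5) by (intro order_tendstoD) auto
  then obtain N where N: "\<And>n. N \<le> n \<Longrightarrow> b n < measure lam B / 2"
    by (auto simp: eventually_sequentially)
  have "norm (\<integral>z. torus_char (freq n) z \<partial>\<mu>s) \<le> 1 - \<epsilon> * (measure lam B / 2)" if "N \<le> n" for n
  proof -
    have "norm (\<integral>z. torus_char (freq n) z \<partial>\<mu>s) \<le> 1 - \<epsilon> * (measure lam B - b n)"
      unfolding b_def
      using sets_mu sets_lam assms(4,6,7) torus_char_measurable
      by (intro mu.norm_integral_le_of_minorization lam) (auto cong: measurable_cong_sets)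
    also have "\<dots> \<le> 1 - \<epsilon> * (measure lam B / 2)"
      using N[OF that] assms(6) by simp
    finally show ?thesis .
  qed
  then have "P \<notin> strong_solutions (\<lambda>_. toral_map S) (\<lambda>_. \<mu>s)"
    using assms(5,6) by (intro not_strong_if_coefficients_bounded[of N "1 - \<epsilon> * (measure lam B / 2)"]) auto
  with P show False by blast
qed

end
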